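(* There is an algorithm which, given a rank $k$ matroid $M$ on a ground set $E$ of size $n$ with $m$ bases, presented by the list of its bases, decides whether $M$ is threshold and terminates in $O(m^2k^2+n\log n)$ time.
   Context: A rank $k$ matroid $M$ on ground set $E$ is threshold if there is $w:E\to\mathbb{R}$ such that for every $k$-element $B\subseteq E$, $B$ is a basis of $M$ iff $\sum_{b\in B}w(b)>0$. *)

theory Defs
  imports Complex_Main
begin

definition matroid :: "'a set \<Rightarrow> 'a set set \<Rightarrow> bool" where
  "matroid E \<B> \<longleftrightarrow> finite E \<and> \<B> \<noteq> {} \<and> (\<forall>B\<in>\<B>. B \<subseteq> E) \<and>
     (\<forall>A\<in>\<B>. \<forall>B\<in>\<B>. \<forall>a\<in>A - B. \<exists>b\<in>B - A. insert b (A - {a}) \<in> \<B>)"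

definition matroid_of_rank :: "nat \<Rightarrow> 'a set \<Rightarrow> 'a set set \<Rightarrow> bool" where
  "matroid_of_rank k E \<B> \<longleftrightarrow> matroid E \<B> \<and> (\<forall>B\<in>\<B>. card B = k)"

definition threshold_matroid :: "nat \<Rightarrow> 'a set \<Rightarrow> 'a set set \<Rightarrow> bool" where
  "threshold_matroid k E \<B> \<longleftrightarrow>
     (\<exists>w :: 'a \<Rightarrow> real. \<forall>B. B \<subseteq> E \<and> card B = k \<longrightarrow> (B \<in> \<B> \<longleftrightarrow> (\<Sum>b\<in>B. w b) > 0))"

text \<open>
  The machine model is a structured random access machine over the natural numbers: a program
  uses finitely many variables and arrays, indirect addressing is array access, and every
  constant, variable access, array access, arithmetic operation, comparison and control
  instruction costs one unit of time. As usual for unit-cost machines, the only arithmetic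
  operations are addition and (truncated) subtraction; with a unit-cost multiplication
  the model would be unreasonably powerful.
\<close>

type_synonym vname = string

record state =
  vars :: "vname \<Rightarrow> nat"
  arrs :: "vname \<Rightarrow> nat \<Rightarrow> nat"

datatype aexp = Const nat | Var vname | Read vname aexp | Plus aexp aexp | Minus aexp aexp

datatype bexp = Less aexp aexp | Equal aexp aexp | Neg bexp | Conj bexp bexp

datatype com =
    Skip
  | Assign vname aexp
  | Write vname aexp aexp
  | Seq com com
  | Cond bexp com com
  | While bexp com

primrec aval :: "aexp \<Rightarrow> state \<Rightarrow> nat" where
  "aval (Const c) s = c"
| "aval (Var x) s = vars s x"
| "aval (Read a i) s = arrs s a (aval i s)"
| "aval (Plus e1 e2) s = aval e1 s + aval e2 s"
| "aval (Minus e1 e2) s = aval e1 s - aval e2 s"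

primrec acost :: "aexp \<Rightarrow> nat" where
  "acost (Const c) = 1"
| "acost (Var x) = 1"
| "acost (Read a i) = acost i + 1"
| "acost (Plus e1 e2) = acost e1 + acost e2 + 1"
| "acost (Minus e1 e2) = acost e1 + acost e2 + 1"

primrec bval :: "bexp \<Rightarrow> state \<Rightarrow> bool" where
  "bval (Less e1 e2) s \<longleftrightarrow> aval e1 s < aval e2 s"
| "bval (Equal e1 e2) s \<longleftrightarrow> aval e1 s = aval e2 s"
| "bval (Neg b) s \<longleftrightarrow> \<not> bval b s"
| "bval (Conj b1 b2) s \<longleftrightarrow> bval b1 s \<and> bval b2 s"

primrec bcost :: "bexp \<Rightarrow> nat" where
  "bcost (Less e1 e2) = acost e1 + acost e2 + 1"
| "bcost (Equal e1 e2) = acost e1 + acost e2 + 1"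
| "bcost (Neg b) = bcost b + 1"
| "bcost (Conj b1 b2) = bcost b1 + bcost b2 + 1"

text \<open>\<open>runs c s t s'\<close>: started in \<open>s\<close>, program \<open>c\<close> halts in \<open>s'\<close> after exactly \<open>t\<close> time units.\<close>

inductive runs :: "com \<Rightarrow> state \<Rightarrow> nat \<Rightarrow> state \<Rightarrow> bool" where
  Skip: "runs Skip s 1 s"
| Assign: "runs (Assign x e) s (acost e + 1) (s\<lparr>vars := (vars s)(x := aval e s)\<rparr>)"
| Write: "runs (Write a i e) s (acost i + acost e + 1)
            (s\<lparr>arrs := (arrs s)(a := (arrs s a)(aval i s := aval e s))\<rparr>)"
| Seq: "runs c1 s1 t1 s2 \<Longrightarrow> runs c2 s2 t2 s3 \<Longrightarrow> runs (Seq c1 c2) s1 (t1 + t2) s3"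
| CondTrue: "bval b s \<Longrightarrow> runs c1 s t s' \<Longrightarrow> runs (Cond b c1 c2) s (bcost b + 1 + t) s'"
| CondFalse: "\<not> bval b s \<Longrightarrow> runs c2 s t s' \<Longrightarrow> runs (Cond b c1 c2) s (bcost b + 1 + t) s'"
| WhileFalse: "\<not> bval b s \<Longrightarrow> runs (While b c) s (bcost b + 1) s"
| WhileTrue: "bval b s1 \<Longrightarrow> runs c s1 t1 s2 \<Longrightarrow> runs (While b c) s2 t2 s3 \<Longrightarrow>
    runs (While b c) s1 (bcost b + 1 + t1 + t2) s3"

inductive_cases runs_SkipE: "runs Skip s t s'"
inductive_cases runs_AssignE: "runs (Assign x e) s t s'"
inductive_cases runs_WriteE: "runs (Write a i e) s t s'"
inductive_cases runs_SeqE: "runs (Seq c1 c2) s t s'"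
inductive_cases runs_CondE: "runs (Cond b c1 c2) s t s'"
inductive_cases runs_WhileE: "runs (While b c) s t s'"

lemma runs_deterministic:
  "runs c s t s' \<Longrightarrow> runs c s u s'' \<Longrightarrow> u = t \<and> s'' = s'"
proof (induction arbitrary: u s'' rule: runs.induct)
  case (WhileTrue b s1 c t1 s2 t2 s3)
  from WhileTrue.prems WhileTrue.hyps(1) show ?case
    by (auto elim!: runs_WhileE dest!: WhileTrue.IH)
next
  case (WhileFalse b s c)
  from WhileFalse.prems WhileFalse.hyps show ?case
    by (auto elim: runs_WhileE)
next
  case (Seq c1 s1 t1 s2 c2 t2 s3)
  from Seq.prems show ?case
    by (auto elim!: runs_SeqE dest!: Seq.IH)
next
  case (CondTrue b s c1 t s' c2)
  from CondTrue.prems CondTrue.hyps(1) show ?case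
    by (auto elim!: runs_CondE dest!: CondTrue.IH)
next
  case (CondFalse b s c2 t s' c1)
  from CondFalse.prems CondFalse.hyps(1) show ?case
    by (auto elim!: runs_CondE dest!: CondFalse.IH)
qed (auto elim: runs_SkipE runs_AssignE runs_WriteE)

text \<open>
  A presentation of a set system by a list: each member is listed exactly once, as a
  repetition-free list of its elements; both orders are arbitrary.
\<close>

definition listing :: "'a set set \<Rightarrow> 'a list list \<Rightarrow> bool" where
  "listing \<B> Bs \<longleftrightarrow> distinct (map set Bs) \<and> set (map set Bs) = \<B> \<and> (\<forall>b\<in>set Bs. distinct b)"

text \<open>
  The ground set is \<open>{..<n}\<close>. When all lists have length \<open>k\<close>, the \<open>j\<close>-th element of the \<open>i\<close>-th
  list is stored in cell \<open>i * k + j\<close>.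
\<close>

definition input_state :: "nat \<Rightarrow> nat \<Rightarrow> nat list list \<Rightarrow> state" where
  "input_state n k Bs =
     \<lparr>vars = (\<lambda>x. 0)(''n'' := n, ''k'' := k, ''m'' := length Bs),
      arrs = (\<lambda>a i. 0)(''bases'' := (\<lambda>i. if i < length (concat Bs) then concat Bs ! i else 0))\<rparr>"

definition runs_within :: "com \<Rightarrow> state \<Rightarrow> real \<Rightarrow> nat \<Rightarrow> bool" where
  "runs_within c s T r \<longleftrightarrow> (\<exists>t s'. runs c s t s' \<and> real t \<le> T \<and> vars s' ''result'' = r)"

end

theory Submission
  imports Defs
begin

text \<open>
  If a weight function witnesses that a matroid is threshold, replacing an element of a basis by a
  heavier one gives a basis again. Hence the degree of an element (the number of bases containing
  it) orders the ground set like the weights, elements of equal degree are interchangeable, and the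
  greedy basis for the degrees determines all bases. Exchanging two bases for two nonbases with the
  same multiset union shows that at most one degree class lies strictly between the lowest
  class of nonloops and the highest class of noncoloops, and that the greedy basis contains at most
  one element of it or misses at most one. So one of two explicit penalty functions, computable
  from the degrees, already separates bases from nonbases.

  A penalty function separates as soon as every single swap from a basis that stays within the
  maximal penalty of a basis leads to a basis, since sets of small penalty are connected by swaps.
  Conversely every pair of adjacent bases is such a swap, so it suffices to compare the number of
  such swaps with the number of adjacent pairs of bases. Both counts take \<open>O(m\<^sup>2 k\<^sup>2)\<close> steps, because
  at most \<open>m k\<close> elements occur in bases; loops are never inspected and no sorting is needed.
\<close>

section \<open>Separation by penalties\<close>

text \<open>Domination by the greedy basis \<open>S\<close> is a family of inequalities between
  \<open>cnt\<close> values, while a penalty test is one linear inequality. With three classes the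
  family shrinks to \<open>bot A \<le> bot S\<close> and
  \<open>bot A + mid A \<le> bot S + mid S\<close>, and the penalties weight these two:
  \<open>k + 1, k, 0\<close> sums to \<open>bot + k * (bot + mid)\<close> and
  \<open>k + 1, 1, 0\<close> to \<open>k * bot + (bot + mid)\<close>. One sum controls both
  inequalities because \<open>bot S + mid S \<le> k\<close> and the middle class is almost empty
  inside or outside \<open>S\<close>. The trade of bases for nonbases needs elements of the bottom
  and top classes both in \<open>S\<close> and outside. They exist because a class lying entirely on
  one side of \<open>S\<close> could be swapped with a neighbouring class against the order of the
  degrees. A successful test certifies any matroid as threshold; the structure of the degree classes
  only shows that a threshold matroid cannot fail both tests. Looking up whether a swapped set is a
  listed basis would need a search structure. Comparing two counts avoids it: membership marks are
  enough.\<close>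

definition deg :: "'a set set \<Rightarrow> 'a \<Rightarrow> nat" where
  "deg \<B> e = card {B \<in> \<B>. e \<in> B}"

definition cnt :: "('a \<Rightarrow> nat) \<Rightarrow> nat \<Rightarrow> 'a set \<Rightarrow> nat" where
  "cnt d \<theta> A = card {e \<in> A. d e \<le> \<theta>}"

lemma card_swap:
  assumes "finite B" "a \<in> B" "b \<notin> B"
  shows "card (insert b (B - {a})) = card B"
  using assms by (metis Diff_iff card.insert card_Suc_Diff1 finite_Diff)

lemma sum_swap:
  fixes f :: "'a \<Rightarrow> 'b::ab_group_add"
  assumes "finite B" "a \<in> B" "b \<notin> B"
  shows "sum f (insert b (B - {a})) = sum f B - f a + f b"
  using assms by (simp add: sum.insert_remove sum_diff1)

lemma sum_swap_nat:
  fixes f :: "'a \<Rightarrow> nat"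
  assumes "finite B" "a \<in> B" "b \<notin> B"
  shows "sum f (insert b (B - {a})) + f a = sum f B + f b"
  using assms by (simp add: sum.remove[of B a])

lemma cnt_swap:
  assumes "finite B" "a \<in> B" "b \<notin> B"
  shows "cnt d \<theta> (insert b (B - {a})) + of_bool (d a \<le> \<theta>) = cnt d \<theta> B + of_bool (d b \<le> \<theta>)"
proof -
  have cnt_sum: "cnt d \<theta> A = (\<Sum>e\<in>A. of_bool (d e \<le> \<theta>))" if "finite A" for A
    using that by (simp add: cnt_def Int_def)
  show ?thesis
    using sum_swap_nat[OF assms, of "\<lambda>e. of_bool (d e \<le> \<theta>)"] assms(1) by (simp add: cnt_sum)
qed

text \<open>Replacing \<open>b\<close> by \<open>a\<close> where \<open>a\<close> is absent maps the
  bases through \<open>b\<close> injectively to bases through \<open>a\<close>: the image still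
  contains \<open>b\<close> exactly if nothing was replaced. This carries the order of the unknown
  weights over to the degrees.\<close>

lemma deg_le:
  assumes "finite \<B>"
    and "\<And>B. B \<in> \<B> \<Longrightarrow> b \<in> B \<Longrightarrow> a \<notin> B \<Longrightarrow> insert a (B - {b}) \<in> \<B>"
  shows "deg \<B> b \<le> deg \<B> a"
proof -
  let ?f = "\<lambda>B. if a \<in> B then B else insert a (B - {b})"
  have "inj_on ?f {B \<in> \<B>. b \<in> B}"
    by (auto simp: inj_on_def split: if_splits)
  moreover have "?f ` {B \<in> \<B>. b \<in> B} \<subseteq> {B \<in> \<B>. a \<in> B}"
    using assms(2) by auto
  ultimately show ?thesis
    unfolding deg_def using assms(1) by (intro card_inj_on_le[where f = ?f]) auto
qed

text \<open>The bases containing both elements cancel, so equal degrees make the two remaining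
  families equally large. The injection from one into the other is then onto, and inverting it gives
  the opposite swap.\<close>

lemma swap_if_deg_eq:
  assumes "finite \<B>" "deg \<B> a = deg \<B> b"
    and ab: "\<And>B. B \<in> \<B> \<Longrightarrow> a \<in> B \<Longrightarrow> b \<notin> B \<Longrightarrow> insert b (B - {a}) \<in> \<B>"
    and B: "B \<in> \<B>" "b \<in> B" "a \<notin> B"
  shows "insert a (B - {b}) \<in> \<B>"
proof -
  let ?A = "{B \<in> \<B>. a \<in> B \<and> b \<notin> B}" and ?B = "{B \<in> \<B>. b \<in> B \<and> a \<notin> B}"
  let ?C = "{B \<in> \<B>. b \<in> B \<and> a \<in> B}"
  let ?f = "\<lambda>B. insert b (B - {a})"
  have "deg \<B> x = card {B \<in> \<B>. x \<in> B \<and> y \<notin> B} + card {B \<in> \<B>. x \<in> B \<and> y \<in> B}" for x y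
    unfolding deg_def using assms(1) by (subst card_Un_disjoint[symmetric]) (auto intro: arg_cong[where f = card])
  from this[of a b] this[of b a] have "deg \<B> a = card ?A + card ?C" "deg \<B> b = card ?B + card ?C"
    by (auto simp: conj_commute)
  then have card: "card ?A = card ?B" using assms(2) by simp
  have inj: "inj_on ?f ?A"
    by (auto simp: inj_on_def)
  have sub: "?f ` ?A \<subseteq> ?B" using ab B by auto
  have "?f ` ?A = ?B"
    using card_image[OF inj] card sub assms(1) by (intro card_subset_eq) auto
  then obtain B' where "B' \<in> ?A" "B = ?f B'" using B by auto
  then have "insert a (B - {b}) = B'" by auto
  then show ?thesis using \<open>B' \<in> ?A\<close> by auto
qed

text \<open>If moving \<open>B\<close> towards \<open>N\<close> by one swap does not lower the penalty, then moving \<open>N\<close> towards \<open>B\<close>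
  does not raise it.\<close>

lemma penalty_set_if_swap_closed:
  fixes v :: "'a \<Rightarrow> nat"
  assumes "finite E" "\<And>B. B \<in> \<B> \<Longrightarrow> B \<subseteq> E \<and> card B = k"
    and le: "\<And>B. B \<in> \<B> \<Longrightarrow> sum v B \<le> T"
    and cl: "\<And>B a b. \<lbrakk>B \<in> \<B>; a \<in> B; b \<in> E - B; sum v (insert b (B - {a})) \<le> T\<rbrakk> \<Longrightarrow>
          insert b (B - {a}) \<in> \<B>"
    and "B \<in> \<B>" "N \<subseteq> E" "card N = k" "sum v N \<le> T"
  shows "N \<in> \<B>"
  using assms(5-8)
proof (induction "card (N - B)" arbitrary: B N)
  case 0
  have "finite N" "finite B" using 0 assms(1,2) finite_subset by blast+
  then have "N \<subseteq> B" using 0 by simp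
  then have "N = B" using 0 assms(2) \<open>finite B\<close> by (metis card_subset_eq)
  then show ?case using 0 by simp
next
  case (Suc x)
  have fin: "finite N" "finite B" using Suc.prems assms(1,2) finite_subset by blast+
  obtain b where b: "b \<in> N" "b \<notin> B"
    using Suc.hyps(2) by (metis card.empty Diff_iff all_not_in_conv nat.distinct(1))
  have "card B = card N" using Suc.prems assms(2) by simp
  then have "\<not> B \<subseteq> N" using b fin by (metis card_subset_eq)
  then obtain a where a: "a \<in> B" "a \<notin> N" by auto
  have cd: "card (N - B - {b}) = x" using Suc.hyps(2) b fin by simp
  show ?case
  proof (cases "v b \<le> v a")
    case True
    have "sum v (insert b (B - {a})) \<le> T"
      using sum_swap_nat[of B a b v] True a b fin le[OF Suc.prems(1)] by linarith
    then have "insert b (B - {a}) \<in> \<B>"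
      using cl Suc.prems a b by auto
    moreover have "N - insert b (B - {a}) = N - B - {b}" using a by auto
    ultimately show ?thesis using Suc.hyps(1) Suc.prems cd by metis
  next
    case False
    let ?N = "insert a (N - {b})"
    have "sum v ?N \<le> T"
      using sum_swap_nat[of N b a v] False a b fin Suc.prems by linarith
    moreover have "card ?N = k" using card_swap[of N b a] a b fin Suc.prems by simp
    moreover have "?N \<subseteq> E" using Suc.prems a assms(2) by auto
    moreover have "?N - B = N - B - {b}" using a by auto
    ultimately have "?N \<in> \<B>" using Suc.hyps(1) Suc.prems cd by metis
    \<comment> \<open>The induction made the lowered set a basis. One swap leads from it back to
      \<open>N\<close>, and \<open>cl\<close> admits this swap because \<open>N\<close> itself has
      penalty at most \<open>T\<close>.\<close>
    moreover have "insert b (?N - {a}) = N" using a b by auto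
    ultimately show ?thesis using cl[of ?N a b] a b Suc.prems by auto
  qed
qed

lemma threshold_if_penalty:
  fixes v :: "'a \<Rightarrow> nat"
  assumes "k > 0" "\<And>B. B \<subseteq> E \<Longrightarrow> card B = k \<Longrightarrow> B \<in> \<B> \<longleftrightarrow> sum v B \<le> T"
  shows "threshold_matroid k E \<B>"
proof -
  \<comment> \<open>The amount \<open>T + 1/2\<close> is spread evenly over \<open>k\<close>
    elements, so a \<open>k\<close>-set weighs \<open>T + 1/2\<close> minus its penalty; the half
    turns \<open>\<le>\<close> between integers into strict positivity.\<close>
  define w where "w e = (real T + 1/2) / real k - real (v e)" for e
  have "sum w B > 0 \<longleftrightarrow> sum v B \<le> T" if "card B = k" for B
  proof -
    have "sum w B = real T + 1/2 - real (sum v B)"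
      using that assms(1) by (simp add: w_def sum_subtractf)
    then show ?thesis by linarith
  qed
  then show ?thesis
    unfolding threshold_matroid_def using assms(2) by (intro exI[of _ w]) auto
qed

text \<open>Loops and coloops are excluded from the tested swaps; they get prohibitive penalties and
  rewards when the swap-closed penalty \<open>u\<close> is turned into threshold weights.\<close>

definition swap_closed :: "'a set set \<Rightarrow> ('a \<Rightarrow> nat) \<Rightarrow> nat \<Rightarrow> bool" where
  "swap_closed \<B> u T \<longleftrightarrow> (\<forall>B\<in>\<B>. \<forall>a\<in>B. \<forall>b\<in>\<Union>\<B> - B. deg \<B> a < card \<B> \<and> sum u B + u b \<le> T + u a \<longrightarrow>
     insert b (B - {a}) \<in> \<B>)"

lemma deg_eq_card_iff:
  assumes "finite \<B>"
  shows "deg \<B> e = card \<B> \<longleftrightarrow> (\<forall>B\<in>\<B>. e \<in> B)"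
proof -
  have "deg \<B> e = card \<B> \<longleftrightarrow> {B \<in> \<B>. e \<in> B} = \<B>"
    unfolding deg_def using assms by (metis (no_types, lifting) card_subset_eq mem_Collect_eq subsetI)
  then show ?thesis by auto
qed

lemma deg_le_card: "finite \<B> \<Longrightarrow> deg \<B> e \<le> card \<B>"
  unfolding deg_def by (rule card_mono) auto

lemma deg_pos_iff: "finite \<B> \<Longrightarrow> deg \<B> e > 0 \<longleftrightarrow> e \<in> \<Union>\<B>"
  unfolding deg_def by (auto simp: card_gt_0_iff)

lemma threshold_if_swap_closed:
  assumes M: "matroid_of_rank k E \<B>" and k: "k > 0"
    and le: "\<And>B. B \<in> \<B> \<Longrightarrow> sum u B \<le> T" and cl: "swap_closed \<B> u T"
  shows "threshold_matroid k E \<B>"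
proof -
  have E: "finite E" and ne: "\<B> \<noteq> {}" and BE: "\<And>B. B \<in> \<B> \<Longrightarrow> B \<subseteq> E \<and> card B = k"
    using M by (auto simp: matroid_of_rank_def matroid_def)
  have fB: "finite \<B>" using E BE by (meson PowI finite_Pow_iff finite_subset subsetI)
  define C where "C = \<Inter>\<B>"
  have CB: "C \<subseteq> B" if "B \<in> \<B>" for B using that by (auto simp: C_def)
  have CE: "C \<subseteq> E" using ne BE CB by blast
  have fC: "finite C" using CE E finite_subset by blast
  have Ck: "card C \<le> k" using ne BE CB E by (metis all_not_in_conv card_mono finite_subset)
  \<comment> \<open>Each element outside \<open>C\<close> costs an extra \<open>Q\<close>, and a
    \<open>k\<close>-set containing \<open>C\<close> has exactly \<open>k - card C\<close> of them,
    whence \<open>T'\<close>. One surplus \<open>Q\<close> exceeds the whole budget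
    \<open>T\<close>, so omitting a coloop is never affordable.\<close>
  define Q where "Q = T + 1"
  define T' where "T' = T + Q * (k - card C)"
  define v where "v e = (if e \<notin> \<Union>\<B> then T' + 1 else if e \<in> C then u e else u e + Q)" for e
  have split: "sum v B = sum u B + Q * (k - card C)" if "B \<subseteq> \<Union>\<B>" "C \<subseteq> B" "card B = k" "finite B" for B
  proof -
    have "sum v B = (\<Sum>e\<in>B. u e + (if e \<in> B - C then Q else 0))"
      using that by (intro sum.cong) (auto simp: v_def)
    also have "\<dots> = sum u B + Q * card (B - C)"
      unfolding sum.distrib using that
      by (subst sum.mono_neutral_cong_right[where S = "B - C" and h = "\<lambda>_. Q"]) (auto simp: mult.commute)
    finally show ?thesis using that fC by (simp add: card_Diff_subset)
  qed
  have big: "T' < sum v B" if "B \<subseteq> E" "card B = k" "\<not> (B \<subseteq> \<Union>\<B> \<and> C \<subseteq> B)" for B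
  proof (cases "B \<subseteq> \<Union>\<B>")
    case False
    then obtain e where "e \<in> B" "e \<notin> \<Union>\<B>" by auto
    then have "v e \<le> sum v B" using that E by (meson finite_subset member_le_sum zero_le)
    then show ?thesis using \<open>e \<notin> \<Union>\<B>\<close> by (simp add: v_def)
  next
    case True
    have fin: "finite B" using that E finite_subset by blast
    have "B \<inter> C \<subset> C" using True that by auto
    then have "card (B \<inter> C) < card C" using fC by (simp add: psubset_card_mono)
    moreover have "card (B - C) = k - card (B \<inter> C)" using that fin by (metis card_Diff_subset_Int finite_Int)
    ultimately have "k - card C + 1 \<le> card (B - C)" using Ck by linarith
    then have "Q * (k - card C + 1) \<le> Q * card (B - C)" by (rule mult_le_mono2)
    also have "\<dots> = (\<Sum>e\<in>B - C. Q)" by simp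
    also have "\<dots> \<le> sum v (B - C)" using True by (intro sum_mono) (auto simp: v_def)
    also have "\<dots> \<le> sum v B" using fin by (intro sum_mono2) auto
    finally show ?thesis by (simp add: T'_def Q_def)
  qed
  have le': "sum v B \<le> T'" if "B \<in> \<B>" for B
    using split[of B] that CB BE[OF that] le[OF that] E finite_subset unfolding T'_def by force
  have "insert b (B - {a}) \<in> \<B>"
    if B: "B \<in> \<B>" and a: "a \<in> B" and b: "b \<in> E - B" and s: "sum v (insert b (B - {a})) \<le> T'" for B a b
  proof -
    let ?N = "insert b (B - {a})"
    have fin: "finite B" using B BE E finite_subset by blast
    have N: "?N \<subseteq> E" "card ?N = k" using B b BE[OF B] card_swap[OF fin a] by auto
    \<comment> \<open>Staying within \<open>T'\<close> forces \<open>b\<close> to lie in some basis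
      and \<open>a\<close> to be no coloop, so the restricted test \<open>swap_closed\<close>
      applies.\<close>
    have *: "?N \<subseteq> \<Union>\<B> \<and> C \<subseteq> ?N" using big[OF N] s by linarith
    have "a \<notin> C" using * a b by auto
    then have "deg \<B> a < card \<B>"
      using deg_eq_card_iff[OF fB] deg_le_card[OF fB] by (metis C_def InterI le_neq_implies_less)
    moreover have "sum u ?N \<le> T" using split[of ?N] * N s fin by (simp add: T'_def)
    then have "sum u B + u b \<le> T + u a" using sum_swap_nat[OF fin a, of b u] b by simp
    ultimately show ?thesis using cl B a b * unfolding swap_closed_def by auto
  qed
  note cl' = this
  obtain B0 where B0: "B0 \<in> \<B>" using ne by auto
  have "B \<in> \<B> \<longleftrightarrow> sum v B \<le> T'" if "B \<subseteq> E" "card B = k" for B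
    using penalty_set_if_swap_closed[OF E BE le' cl' B0 that] le' by blast
  then show ?thesis by (rule threshold_if_penalty[OF k])
qed

section \<open>Greedy bases and domination\<close>

text \<open>A basis minimising the sum of \<open>d\<close> is optimal for all cutoffs at once. Any
  other basis is exchanged towards it by removing elements above the cutoff; once none is left to
  remove, a larger count would allow an exchange in \<open>S\<close> that lowers the sum.\<close>

lemma greedy_basis_exists:
  assumes M: "matroid_of_rank k E \<B>"
  shows "\<exists>S\<in>\<B>. \<forall>B\<in>\<B>. \<forall>\<theta>. cnt d \<theta> B \<le> cnt d \<theta> S"
proof -
  have E: "finite E" and ne: "\<B> \<noteq> {}" and BE: "\<And>B. B \<in> \<B> \<Longrightarrow> B \<subseteq> E \<and> card B = k"
    and ex: "\<And>A B a. \<lbrakk>A \<in> \<B>; B \<in> \<B>; a \<in> A - B\<rbrakk> \<Longrightarrow> \<exists>b\<in>B - A. insert b (A - {a}) \<in> \<B>"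
    using M by (auto simp: matroid_of_rank_def matroid_def)
  have fin: "finite B" if "B \<in> \<B>" for B using that BE E finite_subset by blast
  obtain S where S: "S \<in> \<B>" "\<And>B. B \<in> \<B> \<Longrightarrow> sum d S \<le> sum d B"
    using ex_has_least_nat[of "\<lambda>B. B \<in> \<B>" _ "sum d"] ne by blast
  have "cnt d \<theta> B \<le> cnt d \<theta> S" if "B \<in> \<B>" for B \<theta>
    using that
  proof (induction "card (B - S)" arbitrary: B rule: less_induct)
    case less
    show ?case
    proof (cases "\<exists>b\<in>B - S. \<theta> < d b")
      case True
      then obtain b where b: "b \<in> B - S" "\<theta> < d b" by auto
      then obtain s where s: "s \<in> S - B" "insert s (B - {b}) \<in> \<B>" using ex less.prems S(1) by blast
      have "insert s (B - {b}) - S = B - S - {b}" using s by auto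
      then have "card (insert s (B - {b}) - S) < card (B - S)"
        using b fin[OF less.prems] by (metis card_Diff1_less finite_Diff)
      then have "cnt d \<theta> (insert s (B - {b})) \<le> cnt d \<theta> S" using less.hyps s by blast
      then show ?thesis using cnt_swap[OF fin[OF less.prems], of b s d \<theta>] b s by auto
    next
      case False
      show ?thesis
      proof (rule ccontr)
        assume "\<not> cnt d \<theta> B \<le> cnt d \<theta> S"
        moreover have *: "card A = cnt d \<theta> A + card {e \<in> A. \<theta> < d e}" if "finite A" for A
        proof -
          have "A = {e \<in> A. d e \<le> \<theta>} \<union> {e \<in> A. \<theta> < d e}" by auto
          then show ?thesis using that unfolding cnt_def
            by (subst (1) \<open>A = _\<close>, subst card_Un_disjoint) auto
        qed
        moreover have "card B = card S" using BE less.prems S(1) by metis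
        ultimately have "card {e \<in> B. \<theta> < d e} < card {e \<in> S. \<theta> < d e}"
          using fin[OF less.prems] fin[OF S(1)] *[of B] *[of S] by linarith
        then have "\<not> {e \<in> S. \<theta> < d e} \<subseteq> {e \<in> B. \<theta> < d e}"
          using fin[OF less.prems] by (metis (no_types, lifting) card_mono finite_Collect_conjI finite_subset
            leD mem_Collect_eq subsetI)
        then obtain a where a: "a \<in> S - B" "\<theta> < d a" by auto
        then obtain b where b: "b \<in> B - S" "insert b (S - {a}) \<in> \<B>" using ex less.prems S(1) by blast
        have "\<not> \<theta> < d b" using False b by blast
        then have "d b < d a" using a by linarith
        then show False
          using S(2)[OF b(2)] sum_swap_nat[OF fin[OF S(1)], of a b d] a b by auto
      qed
    qed
  qed
  then show ?thesis using S by auto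
qed

text \<open>Walk from \<open>A\<close> to \<open>B\<close>, swapping the lowest element of
  \<open>A - B\<close> for the lowest of \<open>B - A\<close>. Domination makes each swap go weakly
  upwards in \<open>d\<close>, hence admissible by \<open>dom\<close>, and domination survives the
  swap.\<close>

lemma basis_if_dominated:
  assumes E: "finite E" and BE: "\<And>B. B \<in> \<B> \<Longrightarrow> B \<subseteq> E \<and> card B = k"
    and dom: "\<And>B a b. \<lbrakk>B \<in> \<B>; b \<in> B; a \<in> E - B; d b \<le> d a\<rbrakk> \<Longrightarrow> insert a (B - {b}) \<in> \<B>"
    and "A \<in> \<B>" "B \<subseteq> E" "card B = k" "\<And>\<theta>. cnt d \<theta> B \<le> cnt d \<theta> A"
  shows "B \<in> \<B>"
  using assms(4-)
proof (induction "card (A - B)" arbitrary: A)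
  case 0
  have "finite A" "finite B" using 0 E BE finite_subset by blast+
  then have "A \<subseteq> B" using 0 by simp
  then show ?case using 0 BE \<open>finite B\<close> by (metis card_subset_eq)
next
  case (Suc x)
  have fin: "finite A" "finite B" using Suc.prems E BE finite_subset by blast+
  have card: "card A = card B" using BE Suc.prems by metis
  have neA: "A - B \<noteq> {}" using Suc.hyps(2) by force
  then have neB: "B - A \<noteq> {}" using card fin by (metis Diff_eq_empty_iff card_subset_eq)
  obtain a where a: "a \<in> A - B" "\<And>a'. a' \<in> A - B \<Longrightarrow> d a \<le> d a'"
    using ex_has_least_nat[of "\<lambda>a. a \<in> A - B" _ d] neA by blast
  obtain b where b: "b \<in> B - A" "\<And>b'. b' \<in> B - A \<Longrightarrow> d b \<le> d b'"
    using ex_has_least_nat[of "\<lambda>b. b \<in> B - A" _ d] neB by blast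
  have ab: "d a \<le> d b"
  proof (rule ccontr)
    assume "\<not> d a \<le> d b"
    then have "{e \<in> A. d e \<le> d b} \<subset> {e \<in> B. d e \<le> d b}"
      using a b by (fastforce simp: psubset_eq)
    then have "cnt d (d b) A < cnt d (d b) B"
      unfolding cnt_def using fin by (simp add: psubset_card_mono)
    then show False using Suc.prems(4)[of "d b"] by simp
  qed
  let ?A = "insert b (A - {a})"
  have A: "?A \<in> \<B>" using dom[of A a b] ab a b Suc.prems by auto
  \<comment> \<open>Only cutoffs from \<open>d a\<close> to just below \<open>d b\<close> lose an
    element of \<open>A\<close>. Up to such a cutoff \<open>B\<close> has nothing outside
    \<open>A\<close>, while \<open>A\<close> has the additional \<open>a\<close>, so the inequality
    was strict there.\<close>
  have "cnt d \<theta> B \<le> cnt d \<theta> ?A" for \<theta>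
  proof (cases "d a \<le> \<theta> \<and> \<theta> < d b")
    case True
    then have "{e \<in> B. d e \<le> \<theta>} \<subset> {e \<in> A. d e \<le> \<theta>}"
      using a b by (fastforce simp: psubset_eq)
    then have "cnt d \<theta> B < cnt d \<theta> A"
      unfolding cnt_def using fin by (simp add: psubset_card_mono)
    then show ?thesis using cnt_swap[OF fin(1), of a b d \<theta>] a b True by simp
  next
    case False
    then show ?thesis using cnt_swap[OF fin(1), of a b d \<theta>] a b ab Suc.prems(4)[of \<theta>]
      by (auto split: if_splits)
  qed
  moreover have "?A - B = A - B - {a}" using b by auto
  then have "card (?A - B) = x" using Suc.hyps(2) a fin by simp
  ultimately show ?case using Suc.hyps(1) A Suc.prems by metis
qed

section \<open>Degrees in threshold matroids\<close>

text \<open>The degrees order the ground set the way the unknown weights do, so \<open>S\<close>, the greedy basis for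
  the degrees, determines the matroid.\<close>

locale degree_threshold =
  fixes E :: "'a set" and \<B> :: "'a set set" and k :: nat and w :: "'a \<Rightarrow> real" and S :: "'a set"
  assumes M: "matroid_of_rank k E \<B>"
    and w: "\<And>B. B \<subseteq> E \<Longrightarrow> card B = k \<Longrightarrow> B \<in> \<B> \<longleftrightarrow> sum w B > 0"
    and S: "S \<in> \<B>" "\<And>B \<theta>. B \<in> \<B> \<Longrightarrow> cnt (deg \<B>) \<theta> B \<le> cnt (deg \<B>) \<theta> S"
begin

abbreviation d where "d \<equiv> deg \<B>"
abbreviation m where "m \<equiv> card \<B>"

lemma finE: "finite E" and BE: "B \<in> \<B> \<Longrightarrow> B \<subseteq> E" and Bk: "B \<in> \<B> \<Longrightarrow> card B = k"
  using M by (auto simp: matroid_of_rank_def matroid_def)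

lemma fin: "B \<in> \<B> \<Longrightarrow> finite B"
  using BE finE finite_subset by blast

lemma finB: "finite \<B>"
  using finE BE by (meson PowI finite_Pow_iff finite_subset subsetI)

lemma swap_weight:
  assumes "B \<in> \<B>" "b \<in> B" "a \<in> E - B" "w b \<le> w a"
  shows "insert a (B - {b}) \<in> \<B>"
proof -
  have "sum w (insert a (B - {b})) = sum w B - w b + w a"
    using sum_swap[OF fin[OF assms(1)], of b a w] assms by auto
  moreover have "sum w B > 0" using w BE Bk assms(1) by blast
  moreover have "card (insert a (B - {b})) = k"
    using card_swap[OF fin[OF assms(1)], of b a] assms Bk by auto
  ultimately show ?thesis using w[of "insert a (B - {b})"] assms BE[OF assms(1)] by auto
qed

text \<open>If the weights disagree with the degrees, the reverse swap raises the weight, so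
  \<open>d a \<le> d b\<close>. The degrees are then equal, and \<open>swap_if_deg_eq\<close> turns
  the swaps around.\<close>

lemma swap_degree:
  assumes "B \<in> \<B>" "b \<in> B" "a \<in> E - B" "d b \<le> d a"
  shows "insert a (B - {b}) \<in> \<B>"
proof (cases "w b \<le> w a")
  case True
  then show ?thesis using swap_weight assms by blast
next
  case False
  have bE: "b \<in> E" using assms BE by auto
  have sw: "insert b (B - {a}) \<in> \<B>" if "B \<in> \<B>" "a \<in> B" "b \<notin> B" for B
    using swap_weight[of B a b] that False bE by auto
  then have "d a \<le> d b" using deg_le[OF finB] by blast
  then show ?thesis using swap_if_deg_eq[OF finB, of a b B] sw assms by auto
qed

lemma basis_if_cnt_le:
  assumes "B \<subseteq> E" "card B = k" "\<And>\<theta>. cnt d \<theta> B \<le> cnt d \<theta> S"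
  shows "B \<in> \<B>"
  using basis_if_dominated[where \<B> = \<B> and k = k and d = d and A = S and B = B and E = E]
    finE BE Bk swap_degree S(1) assms by blast

text \<open>A downward swap raises \<open>cnt\<close> by one precisely at the cutoffs from
  \<open>d a\<close> to just below \<open>d b\<close>; slack there keeps the new set dominated by
  \<open>S\<close>.\<close>

lemma swap_basis_if_cnt_le:
  assumes "B \<in> \<B>" "b \<in> B" "a \<in> E - B"
    and "\<And>\<theta>. d a \<le> \<theta> \<Longrightarrow> \<theta> < d b \<Longrightarrow> cnt d \<theta> B < cnt d \<theta> S"
  shows "insert a (B - {b}) \<in> \<B>"
proof (rule basis_if_cnt_le)
  show "insert a (B - {b}) \<subseteq> E" using assms BE by auto
  show "card (insert a (B - {b})) = k" using card_swap[OF fin[OF assms(1)]] Bk assms by auto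
  fix \<theta>
  show "cnt d \<theta> (insert a (B - {b})) \<le> cnt d \<theta> S"
    using cnt_swap[OF fin[OF assms(1)], of b a d \<theta>] assms(2,3) assms(4)[of \<theta>] S(2)[OF assms(1), of \<theta>]
    by (cases "d a \<le> \<theta>"; cases "d b \<le> \<theta>") auto
qed

text \<open>Otherwise let \<open>x\<close> be a highest element of \<open>S\<close> below the class.
  The count of \<open>S\<close> is constant from \<open>d x\<close> up to \<open>d e\<close>, so a
  basis through \<open>e\<close> has slack in between and can swap \<open>e\<close> for
  \<open>x\<close>. This gives \<open>d e \<le> d x\<close>, a contradiction.\<close>

lemma degree_class_meets_S:
  assumes "e \<in> E" "d e > 0"
  shows "\<exists>x\<in>S. d x = d e"
proof (rule ccontr)
  assume no: "\<not> (\<exists>x\<in>S. d x = d e)"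
  obtain B where B: "B \<in> \<B>" "e \<in> B" using assms deg_pos_iff[OF finB] by auto
  have "{x \<in> B. d x \<le> d e} \<noteq> {}" using B by auto
  then have "cnt d (d e) B > 0" unfolding cnt_def using fin[OF B(1)] by (simp add: card_gt_0_iff)
  then have "cnt d (d e) S > 0" using S(2)[OF B(1)] by (metis gr0I leD)
  then have "{x \<in> S. d x \<le> d e} \<noteq> {}" unfolding cnt_def by (metis card.empty less_irrefl)
  then obtain x0 where x0: "x0 \<in> S" "d x0 \<le> d e" by auto
  define D where "D = {x \<in> S. d x \<le> d e}"
  have "finite D" "D \<noteq> {}" unfolding D_def using fin[OF S(1)] x0 by auto
  then have "Max (d ` D) \<in> d ` D" by (intro Max_in) auto
  then obtain x where "x \<in> D" "d x = Max (d ` D)" by auto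
  then have x: "x \<in> D" "\<And>y. y \<in> D \<Longrightarrow> d y \<le> d x" using \<open>finite D\<close> by auto
  have xS: "x \<in> S" "d x < d e" using x(1) no unfolding D_def by force+
  have "insert x (B - {e}) \<in> \<B>" if B: "B \<in> \<B>" "e \<in> B" "x \<notin> B" for B
  proof (rule swap_basis_if_cnt_le)
    show "x \<in> E - B" using xS BE[OF S(1)] B by auto
    fix \<theta> assume \<theta>: "d x \<le> \<theta>" "\<theta> < d e"
    have "d y \<le> \<theta> \<longleftrightarrow> d y \<le> d e" if "y \<in> S" for y
      using x(2)[of y] that \<theta> unfolding D_def by auto
    then have "{y \<in> S. d y \<le> \<theta>} = {y \<in> S. d y \<le> d e}" by blast
    then have "cnt d \<theta> S = cnt d (d e) S" unfolding cnt_def by simp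
    moreover have "{y \<in> B. d y \<le> \<theta>} \<subset> {y \<in> B. d y \<le> d e}"
    proof
      show "{y \<in> B. d y \<le> \<theta>} \<subseteq> {y \<in> B. d y \<le> d e}" using \<theta>(2) by (simp add: Collect_mono_iff)
      show "{y \<in> B. d y \<le> \<theta>} \<noteq> {y \<in> B. d y \<le> d e}" using \<theta>(2) B(2) by (metis (mono_tags) leD mem_Collect_eq order_refl)
    qed
    then have "cnt d \<theta> B < cnt d (d e) B" unfolding cnt_def using fin[OF B(1)] by (simp add: psubset_card_mono)
    ultimately show "cnt d \<theta> B < cnt d \<theta> S" using S(2)[OF B(1), of "d e"] by linarith
  qed (use B in auto)
  then have "d e \<le> d x" by (rule deg_le[OF finB])
  then show False using xS by simp
qed

lemma cnt_split: "finite A \<Longrightarrow> \<theta> \<le> \<theta>' \<Longrightarrow> cnt d \<theta>' A = cnt d \<theta> A + card {x \<in> A. \<theta> < d x \<and> d x \<le> \<theta>'}"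
  unfolding cnt_def by (subst card_Un_disjoint[symmetric]) (auto intro: arg_cong[where f = card])

text \<open>The dual argument: if \<open>S\<close> contained the whole class, bases avoiding
  \<open>e\<close> would have slack from \<open>d e\<close> up to the next degree \<open>d z\<close>
  occurring outside \<open>S\<close>. Then \<open>z\<close> could always be swapped for
  \<open>e\<close>, and \<open>d z \<le> d e\<close>.\<close>

lemma degree_class_not_in_S:
  assumes "e \<in> E" "0 < d e" "d e < m"
  shows "\<exists>x\<in>E - S. d x = d e"
proof (rule ccontr)
  assume no: "\<not> (\<exists>x\<in>E - S. d x = d e)"
  \<comment> \<open>The largest cutoff below the class of \<open>e\<close>; since \<open>d e\<close>
    is positive, the subtraction is exact.\<close>
  define t where "t = d e - 1"
  have t: "t < \<theta> \<longleftrightarrow> d e \<le> \<theta>" for \<theta> using assms by (auto simp: t_def)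
  have less: "cnt d \<theta> B < cnt d \<theta> S"
    if B: "B \<in> \<B>" "e \<notin> B" and \<theta>: "d e \<le> \<theta>" and full: "\<And>x. x \<in> E - S \<Longrightarrow> d e < d x \<Longrightarrow> \<theta> < d x" for B \<theta>
  proof -
    have "{x \<in> B. t < d x \<and> d x \<le> \<theta>} \<subset> {x \<in> S. t < d x \<and> d x \<le> \<theta>}"
    proof
      show "{x \<in> B. t < d x \<and> d x \<le> \<theta>} \<subseteq> {x \<in> S. t < d x \<and> d x \<le> \<theta>}"
      proof clarify
        fix x assume x: "x \<in> B" "t < d x" "d x \<le> \<theta>"
        then have "x \<in> E" "d e \<le> d x" using BE[OF B(1)] t by auto
        then have "x \<in> S" using no full[of x] x(3) by (cases "d x = d e") auto
        then show "x \<in> S \<and> t < d x \<and> d x \<le> \<theta>" using x by auto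
      qed
      show "{x \<in> B. t < d x \<and> d x \<le> \<theta>} \<noteq> {x \<in> S. t < d x \<and> d x \<le> \<theta>}"
        using B \<theta> assms no t by blast
    qed
    then have "card {x \<in> B. t < d x \<and> d x \<le> \<theta>} < card {x \<in> S. t < d x \<and> d x \<le> \<theta>}"
      using fin[OF S(1)] by (simp add: psubset_card_mono)
    moreover have "t \<le> \<theta>" using \<theta> t_def by simp
    ultimately show ?thesis
      using cnt_split[OF fin[OF B(1)], of t \<theta>] cnt_split[OF fin[OF S(1)], of t \<theta>] S(2)[OF B(1), of t] by linarith
  qed
  obtain B where B: "B \<in> \<B>" "e \<notin> B"
    using assms deg_eq_card_iff[OF finB, of e] by auto
  \<comment> \<open>Without a higher degree outside \<open>S\<close> the slack would persist up to
    the cutoff \<open>m\<close>, where both counts equal \<open>k\<close>.\<close>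
  have "\<exists>z. z \<in> E - S \<and> d e < d z"
  proof (rule ccontr)
    assume "\<not> (\<exists>z. z \<in> E - S \<and> d e < d z)"
    then have "cnt d m B < cnt d m S" using less[OF B, of m] assms by auto
    moreover have "cnt d m A = card A" for A
      using deg_le_card[OF finB] by (simp add: cnt_def)
    ultimately show False using Bk[OF B(1)] Bk[OF S(1)] by simp
  qed
  then obtain z where z: "z \<in> E - S" "d e < d z" "\<And>y. y \<in> E - S \<Longrightarrow> d e < d y \<Longrightarrow> d z \<le> d y"
    using ex_has_least_nat[of "\<lambda>z. z \<in> E - S \<and> d e < d z" _ d] by blast
  have "insert e (B - {z}) \<in> \<B>" if B: "B \<in> \<B>" "z \<in> B" "e \<notin> B" for B
  proof (rule swap_basis_if_cnt_le)
    fix \<theta> assume "d e \<le> \<theta>" "\<theta> < d z"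
    then show "cnt d \<theta> B < cnt d \<theta> S" using less[OF B(1,3)] z(3) by (meson less_le_trans)
  qed (use B assms in auto)
  then have "d z \<le> d e" by (rule deg_le[OF finB])
  then show False using z by simp
qed

text \<open>Two bases and two nonbases with the same multiset union cannot be separated by weights.\<close>

lemma no_trade:
  assumes mid: "a \<in> S" "a' \<in> S" "a \<noteq> a'" "b \<in> E - S" "b' \<in> E - S" "b \<noteq> b'" "d a = d b" "d a' = d b'"
    and bot: "f \<in> S" "e \<in> E - S" "d f = d e" "d e < d a" "d e < d a'"
    and top: "l \<in> S" "l' \<in> E - S" "d l = d l'" "d a < d l" "d a' < d l"
  shows False
proof -
  note fS = fin[OF S(1)]
  have ne: "f \<noteq> a" "f \<noteq> a'" "f \<noteq> l" "l \<noteq> a" "l \<noteq> a'" "e \<noteq> b" "e \<noteq> b'" "e \<noteq> l'" "l' \<noteq> b" "l' \<noteq> b'"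
    using assms by auto
  \<comment> \<open>\<open>?N1\<close> trades two middle elements of \<open>S\<close> for a bottom
    and a top one, \<open>?N2\<close> does the opposite, and \<open>?B\<close> does both. Thus
    \<open>S\<close> and \<open>?B\<close> together weigh as much as \<open>?N1\<close> and
    \<open>?N2\<close>. \<open>?B\<close> has the profile of \<open>S\<close>, whereas
    \<open>?N1\<close> exceeds it at the bottom degree and \<open>?N2\<close> just below the top
    degree.\<close>
  let ?N1 = "insert l' (insert e (S - {a}) - {a'})"
  let ?N2 = "insert b' (insert b (S - {f}) - {l})"
  let ?B = "insert b' (insert b (?N1 - {f}) - {l})"
  have f1: "finite (insert e (S - {a}))" "finite (insert b (S - {f}))" "finite ?N1" "finite ?N2"
    "finite (insert b (?N1 - {f}))" using fS by auto
  have [simp]: "e \<notin> S" "b \<notin> S" "b' \<notin> S" "l' \<notin> S" using assms by auto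
  have "k > 0" using Bk[OF S(1)] fS bot(1) card_gt_0_iff by blast
  then have c: "card ?N1 = k" "card ?N2 = k" "card ?B = k"
    using assms ne fS f1 Bk[OF S(1)] by (simp_all add: card_swap)
  have E: "?N1 \<subseteq> E" "?N2 \<subseteq> E" "?B \<subseteq> E" using assms BE[OF S(1)] by auto
  have n1: "cnt d (d e) ?N1 = cnt d (d e) S + 1"
    using cnt_swap[OF fS, of a e d "d e"] cnt_swap[OF f1(1), of a' l' d "d e"] assms ne by auto
  define h where "h = d l - 1"
  have h: "d a \<le> h" "d a' \<le> h" "d f \<le> h" "h < d l" unfolding h_def using assms by auto
  have n2: "cnt d h ?N2 = cnt d h S + 1"
    using cnt_swap[OF fS, of f b d h] cnt_swap[OF f1(2), of l b' d h] h assms ne by auto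
  have "cnt d \<theta> ?B = cnt d \<theta> S" for \<theta>
    using cnt_swap[OF fS, of a e d \<theta>] cnt_swap[OF f1(1), of a' l' d \<theta>]
      cnt_swap[OF f1(3), of f b d \<theta>] cnt_swap[OF f1(5), of l b' d \<theta>] assms ne by auto
  then have "?B \<in> \<B>" using basis_if_cnt_le E c by simp
  then have "sum w ?B > 0" using w[OF E(3) c(3)] by simp
  moreover have "sum w S > 0" using w[OF BE Bk] S(1) by blast
  moreover have "sum w ?N1 \<le> 0" using w[OF E(1) c(1)] S(2)[of ?N1 "d e"] n1 by force
  moreover have "sum w ?N2 \<le> 0" using w[OF E(2) c(2)] S(2)[of ?N2 h] n2 by force
  moreover have "sum w ?N1 = sum w S - w a + w e - w a' + w l'"
    using sum_swap[OF fS, of a e w] sum_swap[OF f1(1), of a' l' w] assms ne by auto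
  moreover have "sum w ?N2 = sum w S - w f + w b - w l + w b'"
    using sum_swap[OF fS, of f b w] sum_swap[OF f1(2), of l b' w] assms ne by auto
  moreover have "sum w ?B = sum w ?N1 - w f + w b - w l + w b'"
    using sum_swap[OF f1(3), of f b w] sum_swap[OF f1(5), of l b' w] assms ne by auto
  ultimately show False by linarith
qed

end

section \<open>Two candidate penalties\<close>

text \<open>The lowest class of nonloops. The inserted \<open>card \<B>\<close> is the start value
  of the scan and harmless, since no degree exceeds it.\<close>

definition min_deg :: "'a set set \<Rightarrow> nat" where
  "min_deg \<B> = Min (insert (card \<B>) (deg \<B> ` \<Union>\<B>))"

text \<open>The highest class of noncoloops; the default 0 means that every nonloop is a
  coloop.\<close>

definition max_deg :: "'a set set \<Rightarrow> nat" where
  "max_deg \<B> = Max (insert 0 {x \<in> deg \<B> ` \<Union>\<B>. x < card \<B>})"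

text \<open>A threshold matroid has at most three degrees strictly between those of loops and coloops, and the
  middle class behaves like \<open>U\<^sub>1\<^sub>,\<^sub>p\<close> or \<open>U\<^sub>p\<^sub>-\<^sub>1\<^sub>,\<^sub>p\<close>. Penalties \<open>k + 1, c, 0\<close> separate in the first case
  for \<open>c = k\<close> and in the second for \<open>c = 1\<close>; with fewer classes \<open>c\<close> is irrelevant.\<close>

definition penalty :: "'a set set \<Rightarrow> nat \<Rightarrow> nat \<Rightarrow> 'a \<Rightarrow> nat" where
  "penalty \<B> k c e = (if deg \<B> e = min_deg \<B> then k + 1 else if deg \<B> e = max_deg \<B> then 0 else c)"

text \<open>Reading the threshold off the bases makes it unnecessary to compute the greedy basis.
  The 0 is the start value of the running maximum.\<close>

definition max_pen :: "'a set set \<Rightarrow> ('a \<Rightarrow> nat) \<Rightarrow> nat" where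
  "max_pen \<B> u = Max (insert 0 (sum u ` \<B>))"

context degree_threshold
begin

abbreviation mn where "mn \<equiv> min_deg \<B>"
abbreviation mx where "mx \<equiv> max_deg \<B>"

lemma m_pos: "0 < m"
  using finB S(1) card_gt_0_iff by blast

lemma finU: "finite (\<Union>\<B>)"
  using finB fin by blast

lemma mx_less: "mx < m"
proof -
  have "mx \<in> insert 0 {x \<in> d ` \<Union>\<B>. x < m}"
    unfolding max_deg_def using finU by (intro Max_in) auto
  then show ?thesis using m_pos by auto
qed

lemma mn_pos: "0 < mn"
proof -
  have "mn \<in> insert m (d ` \<Union>\<B>)"
    unfolding min_deg_def using finU by (intro Min_in) auto
  then show ?thesis using m_pos deg_pos_iff[OF finB] by fastforce
qed

lemma mn_attained: "mn < m \<Longrightarrow> \<exists>e\<in>\<Union>\<B>. d e = mn"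
proof -
  have "mn \<in> insert m (d ` \<Union>\<B>)"
    unfolding min_deg_def using finU by (intro Min_in) auto
  then show "mn < m \<Longrightarrow> ?thesis" by (metis image_iff insert_iff less_irrefl)
qed

lemma mx_attained: "0 < mx \<Longrightarrow> \<exists>e\<in>\<Union>\<B>. d e = mx"
proof -
  have "mx \<in> insert 0 {x \<in> d ` \<Union>\<B>. x < m}"
    unfolding max_deg_def using finU by (intro Max_in) auto
  then show "0 < mx \<Longrightarrow> ?thesis"
    by (metis (mono_tags, lifting) image_iff insert_iff less_irrefl mem_Collect_eq)
qed

lemma mn_le: "e \<in> \<Union>\<B> \<Longrightarrow> mn \<le> d e"
  unfolding min_deg_def using finU by (intro Min_le) auto

lemma le_mx: "e \<in> \<Union>\<B> \<Longrightarrow> d e < m \<Longrightarrow> d e \<le> mx"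
  unfolding max_deg_def using finU by (intro Max_ge) auto

lemma U_E: "\<Union>\<B> \<subseteq> E"
  using BE by auto

section \<open>Bottom, middle and top degree classes\<close>

definition Mid where "Mid = {e \<in> E. mn < d e \<and> d e < mx}"
definition bot where "bot A = card {e \<in> A. d e = mn}"
definition mid where "mid A = card {e \<in> A. mn < d e \<and> d e < mx}"
definition Co where "Co = {e \<in> E. d e = m}"

lemma finMid: "finite Mid"
  unfolding Mid_def using finE by auto

lemma mid_class:
  assumes "e \<in> Mid"
  shows "\<exists>x\<in>S. d x = d e" "\<exists>x\<in>E - S. d x = d e"
  using degree_class_meets_S[of e] degree_class_not_in_S[of e] assms mx_less
  unfolding Mid_def by fastforce+

text \<open>A middle element makes the bottom and top classes distinct and different from loops and
  coloops. By the two class lemmas each has an element in \<open>S\<close> and one outside, which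
  are the four further elements that \<open>no_trade\<close> asks for.\<close>

lemma mid_no_trade:
  assumes "a \<in> S" "a' \<in> S" "a \<noteq> a'" "b \<in> E - S" "b' \<in> E - S" "b \<noteq> b'" "d a = d b" "d a' = d b'"
    and "a \<in> Mid" "a' \<in> Mid"
  shows False
proof -
  have lt: "mn < mx" using assms unfolding Mid_def by auto
  then obtain e0 l0 where e0: "e0 \<in> E" "d e0 = mn" "l0 \<in> E" "d l0 = mx"
    using mn_attained mx_attained mn_pos mx_less U_E by (metis less_trans subsetD)
  obtain f e where "f \<in> S" "d f = mn" "e \<in> E - S" "d e = mn"
    using degree_class_meets_S[of e0] degree_class_not_in_S[of e0] e0 lt mn_pos mx_less by fastforce
  moreover obtain l l' where "l \<in> S" "d l = mx" "l' \<in> E - S" "d l' = mx"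
    using degree_class_meets_S[of l0] degree_class_not_in_S[of l0] e0 lt mn_pos mx_less by fastforce
  ultimately show False
    using no_trade[OF assms(1-8), of f e l l'] assms(9,10) unfolding Mid_def by auto
qed

text \<open>Two middle classes would supply a trade with one element in \<open>S\<close> and one
  outside from each; these are distinct by their degrees.\<close>

lemma mid_unique:
  assumes "e \<in> Mid" "e' \<in> Mid"
  shows "d e = d e'"
proof (rule ccontr)
  assume ne: "d e \<noteq> d e'"
  obtain a a' b b' where *: "a \<in> S" "d a = d e" "a' \<in> S" "d a' = d e'"
    "b \<in> E - S" "d b = d e" "b' \<in> E - S" "d b' = d e'"
    using mid_class assms by meson
  then have "a \<noteq> a'" "b \<noteq> b'" using ne by metis+
  then show False
    using mid_no_trade[of a a' b b'] * assms BE[OF S(1)] unfolding Mid_def by auto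
qed

text \<open>One middle class with two elements in \<open>S\<close> and two outside is the other
  source of a trade.\<close>

lemma mid_small: "card (Mid \<inter> S) \<le> Suc 0 \<or> card (Mid - S) \<le> Suc 0"
proof (rule ccontr)
  assume "\<not> ?thesis"
  then obtain a a' b b' where "a \<in> Mid \<inter> S" "a' \<in> Mid \<inter> S" "a \<noteq> a'"
    "b \<in> Mid - S" "b' \<in> Mid - S" "b \<noteq> b'"
    using finMid by (auto simp: card_le_Suc0_iff_eq)
  moreover have "Mid \<subseteq> E" unfolding Mid_def by auto
  ultimately have *: "a \<in> S" "a' \<in> S" "a \<noteq> a'" "b \<in> E - S" "b' \<in> E - S" "b \<noteq> b'" "a \<in> Mid" "a' \<in> Mid"
    "b \<in> Mid" "b' \<in> Mid" by auto
  then show False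
    using mid_no_trade[OF *(1-6) mid_unique mid_unique] by blast
qed

text \<open>The tested swaps stay in this family, because they insert a nonloop and remove a
  noncoloop. Here \<open>Co\<close> is the set of coloops.\<close>

definition good where "good A \<longleftrightarrow> A \<subseteq> \<Union>\<B> \<and> card A = k \<and> Co \<subseteq> A"

lemma good_basis: "B \<in> \<B> \<Longrightarrow> good B"
  unfolding good_def Co_def using Bk deg_eq_card_iff[OF finB] by auto

lemma goodD:
  assumes "good A"
  shows "finite A" "A \<subseteq> E" "{e \<in> A. d e = m} = Co"
proof -
  have A: "A \<subseteq> \<Union>\<B>" "Co \<subseteq> A" using assms unfolding good_def by auto
  show "finite A" using A(1) finU by (rule finite_subset)
  show "A \<subseteq> E" using A(1) U_E by (rule subset_trans)
  then show "{e \<in> A. d e = m} = Co" using A(2) unfolding Co_def by blast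
qed

text \<open>The disjuncts overlap to cover the degenerate cases: \<open>mn\<close> and
  \<open>mx\<close> may coincide, and if every nonloop is a coloop they are \<open>m\<close> and
  0.\<close>

lemma good_cases:
  assumes "good A" "e \<in> A"
  shows "d e = mn \<and> (mn \<le> mx \<or> d e = m) \<or> e \<in> Mid \<and> mn < d e \<and> d e < mx \<or> mn \<le> d e \<and> d e = mx \<or> mx < d e \<and> mn \<le> d e \<and> d e = m"
proof -
  have e: "e \<in> \<Union>\<B>" "e \<in> E" using assms goodD(2) unfolding good_def by auto
  show ?thesis
    using mn_le[OF e(1)] le_mx[OF e(1)] deg_le_card[OF finB, of e] mx_less e(2) unfolding Mid_def
    by (cases "d e = m") auto
qed

section \<open>The profile of a good set as a step function\<close>

lemma cnt_low:
  assumes "good A" "\<theta> < mn"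
  shows "cnt d \<theta> A = 0"
proof -
  have "\<not> d e \<le> \<theta>" if "e \<in> A" for e using good_cases[OF assms(1) that] assms(2) by auto
  then have "{e \<in> A. d e \<le> \<theta>} = {}" by blast
  then show ?thesis unfolding cnt_def by (metis card.empty)
qed

lemma cnt_bot:
  assumes "good A" "mn \<le> \<theta>" "\<theta> < mx" "\<And>e. e \<in> Mid \<Longrightarrow> \<theta> < d e"
  shows "cnt d \<theta> A = bot A"
proof -
  have "d e \<le> \<theta> \<longleftrightarrow> d e = mn" if "e \<in> A" for e
    using good_cases[OF assms(1) that] assms(2,3) assms(4)[of e] by auto
  then have "{e \<in> A. d e \<le> \<theta>} = {e \<in> A. d e = mn}" by blast
  then show ?thesis unfolding cnt_def bot_def by simp
qed

lemma cnt_mid: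
  assumes "good A" "mn \<le> \<theta>" "\<theta> < mx" "\<And>e. e \<in> Mid \<Longrightarrow> d e \<le> \<theta>"
  shows "cnt d \<theta> A = bot A + mid A"
proof -
  have "d e \<le> \<theta> \<longleftrightarrow> d e = mn \<or> mn < d e \<and> d e < mx" if "e \<in> A" for e
    using good_cases[OF assms(1) that] assms(2,3) assms(4)[of e] by auto
  then have "{e \<in> A. d e \<le> \<theta>} = {e \<in> A. d e = mn} \<union> {e \<in> A. mn < d e \<and> d e < mx}" by blast
  then show ?thesis unfolding cnt_def bot_def mid_def using goodD[OF assms(1)]
    by (subst card_Un_disjoint[symmetric]) auto
qed

lemma cnt_high:
  assumes "good A" "mx \<le> \<theta>"
  shows "cnt d \<theta> A = (if \<theta> < m then k - card Co else k)"
proof -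
  have *: "d e \<le> \<theta> \<longleftrightarrow> \<theta> \<ge> m \<or> d e \<noteq> m" if "e \<in> A" for e
    using good_cases[OF assms(1) that] assms(2) mx_less by auto
  have "{e \<in> A. d e \<le> \<theta>} = (if \<theta> < m then A - Co else A)"
    using * goodD(3)[OF assms(1)] by auto
  moreover have "finite Co" "Co \<subseteq> A" "card A = k"
    using assms goodD(1)[OF assms(1)] finite_subset unfolding good_def by auto
  ultimately show ?thesis unfolding cnt_def by (simp add: card_Diff_subset)
qed

text \<open>The counts of good sets can differ only at cutoffs from \<open>mn\<close> to just below
  \<open>mx\<close>. There they take one value below the middle class and one from it on, so two
  comparisons with \<open>S\<close> decide.\<close>

lemma basis_if_profile:
  assumes A: "good A" and le: "mn < mx \<Longrightarrow> bot A \<le> bot S \<and> bot A + mid A \<le> bot S + mid S"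
  shows "A \<in> \<B>"
proof (rule basis_if_cnt_le)
  show "A \<subseteq> E" "card A = k" using A goodD unfolding good_def by auto
  fix \<theta>
  have S': "good S" using good_basis S by auto
  \<comment> \<open>By \<open>mid_unique\<close> no cutoff splits the middle class.\<close>
  consider "\<theta> < mn" | "mn \<le> \<theta>" "\<theta> < mx" "\<And>e. e \<in> Mid \<Longrightarrow> \<theta> < d e"
    | "mn \<le> \<theta>" "\<theta> < mx" "\<And>e. e \<in> Mid \<Longrightarrow> d e \<le> \<theta>" | "mx \<le> \<theta>"
    using mid_unique by (metis not_le)
  then show "cnt d \<theta> A \<le> cnt d \<theta> S"
  proof cases
    case 1 then show ?thesis using cnt_low[OF A] by simp
  next
    case 2 then show ?thesis using cnt_bot[OF A 2] cnt_bot[OF S' 2] le by simp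
  next
    case 3 then show ?thesis using cnt_mid[OF A 3] cnt_mid[OF S' 3] le by simp
  next
    case 4 then show ?thesis using cnt_high[OF A 4] cnt_high[OF S' 4] by simp
  qed
qed

lemma basis_profile:
  assumes "mn < mx" "B \<in> \<B>"
  shows "bot B \<le> bot S" "bot B + mid B \<le> bot S + mid S"
proof -
  have g: "good B" "good S" using good_basis S assms by auto
  have "d e \<le> mx - 1" "mn < d e" if "e \<in> Mid" for e using that unfolding Mid_def by auto
  then have "cnt d mn A = bot A" "cnt d (mx - 1) A = bot A + mid A" if "good A" for A
    using cnt_bot[OF that, of mn] cnt_mid[OF that, of "mx - 1"] assms(1) by auto
  then show "bot B \<le> bot S" "bot B + mid B \<le> bot S + mid S"
    using S(2)[OF assms(2)] g by metis+
qed

text \<open>Coloops receive the middle penalty \<open>c\<close>, but all good sets contain the same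
  ones, so the last term cancels in comparisons.\<close>

lemma sum_penalty:
  assumes "mn < mx" "good A"
  shows "sum (penalty \<B> k c) A = (k + 1) * bot A + c * mid A + c * card Co"
proof -
  have "penalty \<B> k c e = (k + 1) * of_bool (d e = mn) + c * of_bool (mn < d e \<and> d e < mx) + c * of_bool (d e = m)"
    if "e \<in> A" for e
    using good_cases[OF assms(2) that] assms(1) mx_less unfolding penalty_def by auto
  then have "sum (penalty \<B> k c) A = (\<Sum>e\<in>A. (k + 1) * of_bool (d e = mn) +
      c * of_bool (mn < d e \<and> d e < mx) + c * of_bool (d e = m))" by (rule sum.cong[OF refl])
  also have "\<dots> = (k + 1) * bot A + c * mid A + c * card {e \<in> A. d e = m}"
    using goodD(1)[OF assms(2)]
    by (simp only: sum.distrib sum_distrib_left[symmetric] bot_def mid_def) (simp add: Int_def)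
  finally show ?thesis using goodD(3)[OF assms(2)] by simp
qed

text \<open>A swap that passes the test yields a good set with penalty at most that of some basis;
  the rest is arithmetic of \<open>bot\<close> and \<open>mid\<close>. The choice
  \<open>c = k\<close> serves \<open>mid S \<le> 1\<close>, and \<open>c = 1\<close> serves a middle
  class with at most one element outside \<open>S\<close>.\<close>

lemma swap_closed_penalty:
  assumes "k > 0"
  shows "\<exists>c\<in>{1, k}. swap_closed \<B> (penalty \<B> k c) (max_pen \<B> (penalty \<B> k c))"
proof -
  have botmid: "bot S + mid S \<le> k"
  proof -
    have "bot S + mid S = card ({e \<in> S. d e = mn} \<union> {e \<in> S. mn < d e \<and> d e < mx})"
      unfolding bot_def mid_def using fin[OF S(1)] by (subst card_Un_disjoint) auto
    also have "\<dots> \<le> card S" using fin[OF S(1)] by (intro card_mono) auto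
    finally show ?thesis using Bk S(1) by simp
  qed
  have midS: "mid S = card (Mid \<inter> S)"
    unfolding mid_def Mid_def using BE[OF S(1)] by (intro arg_cong[where f = card]) auto
  have midA: "mid A \<le> mid S + card (Mid - S)" if "good A" for A
  proof -
    have "mid A \<le> card Mid" unfolding mid_def
      using goodD[OF that] finMid by (intro card_mono) (auto simp: Mid_def)
    also have "\<dots> = card (Mid \<inter> S) + card (Mid - S)"
      using finMid by (metis card_Int_Diff)
    finally show ?thesis using midS by simp
  qed
  \<comment> \<open>Since each middle class meets \<open>S\<close>, \<open>mid S = 0\<close> means
    that there is no middle class.\<close>
  have empty: "mid A = 0" if "good A" "mid S = 0" for A
  proof -
    have "Mid \<inter> S = {}" using that(2) midS finMid by simp
    moreover have "\<exists>x\<in>Mid \<inter> S. True" if "e \<in> Mid" for e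
      using mid_class(1)[OF that] that BE[OF S(1)] unfolding Mid_def by auto
    ultimately have "Mid = {}" by blast
    then have "{e \<in> A. mn < d e \<and> d e < mx} = {}" using goodD(2)[OF that(1)] unfolding Mid_def by blast
    then show ?thesis unfolding mid_def by (metis card.empty)
  qed
  have main: "swap_closed \<B> (penalty \<B> k c) (max_pen \<B> (penalty \<B> k c))"
    if *: "\<And>A B. \<lbrakk>mn < mx; good A; (k + 1) * bot A + c * mid A \<le> (k + 1) * bot B + c * mid B;
       bot B \<le> bot S; bot B + mid B \<le> bot S + mid S; mid S = 0 \<Longrightarrow> mid B = 0\<rbrakk> \<Longrightarrow>
       bot A \<le> bot S \<and> bot A + mid A \<le> bot S + mid S" for c
    unfolding swap_closed_def
  proof (intro ballI impI)
    fix B a b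
    assume B: "B \<in> \<B>" "a \<in> B" "b \<in> \<Union>\<B> - B"
    let ?u = "penalty \<B> k c" and ?A = "insert b (B - {a})"
    assume as: "d a < m \<and> sum ?u B + ?u b \<le> max_pen \<B> ?u + ?u a"
    have g: "good ?A"
      using good_basis[OF B(1)] B as card_swap[OF fin[OF B(1)], of a b] unfolding good_def Co_def by auto
    have "sum ?u ?A \<le> max_pen \<B> ?u"
      using sum_swap_nat[OF fin[OF B(1)], of a b ?u] B as by auto
    moreover have "max_pen \<B> ?u \<in> insert 0 (sum ?u ` \<B>)"
      unfolding max_pen_def using finB by (intro Max_in) auto
    ultimately obtain B' where B': "B' \<in> \<B>" "sum ?u ?A \<le> sum ?u B'" using S(1) by auto
    show "?A \<in> \<B>"
    proof (rule basis_if_profile[OF g])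
      assume lt: "mn < mx"
      show "bot ?A \<le> bot S \<and> bot ?A + mid ?A \<le> bot S + mid S"
      proof (rule *[OF lt g])
        show "(k + 1) * bot ?A + c * mid ?A \<le> (k + 1) * bot B' + c * mid B'"
          using B'(2) sum_penalty[OF lt g] sum_penalty[OF lt good_basis[OF B'(1)]] by simp
      qed (use basis_profile[OF lt B'(1)] empty good_basis[OF B'(1)] in auto)
    qed
  qed
  show ?thesis
  proof (cases "mid S \<le> 1")
    case True
    have "swap_closed \<B> (penalty \<B> k k) (max_pen \<B> (penalty \<B> k k))"
    proof (rule main)
      fix A B
      assume A: "good A" and le: "(k + 1) * bot A + k * mid A \<le> (k + 1) * bot B + k * mid B"
        and B: "bot B \<le> bot S" "bot B + mid B \<le> bot S + mid S" "mid S = 0 \<Longrightarrow> mid B = 0"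
      show "bot A \<le> bot S \<and> bot A + mid A \<le> bot S + mid S"
      proof (cases "mid S = 0")
        case True
        then have z: "mid A = 0" "mid B = 0" using empty A B by auto
        then have "(k + 1) * bot A \<le> (k + 1) * bot B" using le by simp
        then have "bot A \<le> bot B" by (metis mult_le_cancel1 add_gr_0 zero_less_one)
        then show ?thesis using z B by simp
      next
        case False
        then have 1: "mid S = 1" using True by simp
        \<comment> \<open>The total \<open>bot + mid\<close> carries weight \<open>k\<close>, and
          \<open>bot\<close> weight 1. Exceeding the total costs \<open>k\<close>, which
          \<open>bot S \<le> k - 1\<close> cannot repay; a surplus in \<open>bot\<close> makes the
          total at least that of \<open>S\<close> and so cannot be repaid either.\<close>
        have "bot A + k * (bot A + mid A) \<le> bot B + k * (bot B + mid B)"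
          using le by (simp add: algebra_simps)
        also have "\<dots> \<le> bot S + k * (bot S + 1)"
          using add_mono[OF B(1) mult_le_mono2[OF B(2)]] 1 by simp
        finally have le': "bot A + k * (bot A + mid A) \<le> bot S + k * (bot S + 1)" .
        have "bot A + mid A \<le> bot S + 1"
        proof (rule ccontr)
          assume "\<not> ?thesis"
          then have "k * (bot S + 2) \<le> k * (bot A + mid A)" by (intro mult_le_mono2) auto
          then have "k \<le> bot S" using le' by (simp add: algebra_simps)
          then show False using botmid 1 by simp
        qed
        moreover have "bot A \<le> bot S"
        proof (rule ccontr)
          assume as: "\<not> ?thesis"
          then have "k * (bot S + 1) \<le> k * (bot A + mid A)" by (intro mult_le_mono2) auto
          then show False using le' as by simp
        qed
        ultimately show ?thesis using 1 by simp
      qed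
    qed
    then show ?thesis by blast
  next
    case False
    then have one: "card (Mid - S) \<le> 1" using mid_small midS by auto
    have "swap_closed \<B> (penalty \<B> k 1) (max_pen \<B> (penalty \<B> k 1))"
    proof (rule main)
      fix A B
      assume A: "good A" and le: "(k + 1) * bot A + 1 * mid A \<le> (k + 1) * bot B + 1 * mid B"
        and B: "bot B \<le> bot S" "bot B + mid B \<le> bot S + mid S"
      \<comment> \<open>Now \<open>bot\<close> carries weight \<open>k\<close> and the total weight
        1. A surplus in \<open>bot\<close> costs at least \<open>k + 1\<close>, more than
        \<open>mid S\<close>. A deficit in \<open>bot\<close> leaves room for one extra middle
        element, and there is at most one outside \<open>S\<close>.\<close>
      have "k * bot A + (bot A + mid A) \<le> k * bot B + (bot B + mid B)" using le by simp
      also have "\<dots> \<le> k * bot S + (bot S + mid S)"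
        using add_mono[OF mult_le_mono2[OF B(1)] B(2)] by simp
      finally have le': "k * bot A + bot A + mid A \<le> k * bot S + bot S + mid S" by simp
      have 1: "bot A \<le> bot S"
      proof (rule ccontr)
        assume as: "\<not> ?thesis"
        then have "k * (bot S + 1) \<le> k * bot A" by (intro mult_le_mono2) auto
        then have "k * bot S + k \<le> k * bot A" by simp
        then show False using le' as botmid by linarith
      qed
      moreover have "bot A + mid A \<le> bot S + mid S"
      proof (cases "bot A = bot S")
        case True then show ?thesis using le' by simp
      next
        case False then show ?thesis using midA[OF A] one 1 by simp
      qed
      ultimately show "bot A \<le> bot S \<and> bot A + mid A \<le> bot S + mid S" by simp
    qed
    then show ?thesis by blast
  qed
qed

end

section \<open>The decision criterion and its counting form\<close>

theorem threshold_iff_swap_closed: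
  assumes M: "matroid_of_rank k E \<B>"
  shows "threshold_matroid k E \<B> \<longleftrightarrow>
    k > 0 \<and> (\<exists>c\<in>{1, k}. swap_closed \<B> (penalty \<B> k c) (max_pen \<B> (penalty \<B> k c)))"
proof
  assume "threshold_matroid k E \<B>"
  then obtain w where w: "\<And>B. B \<subseteq> E \<Longrightarrow> card B = k \<Longrightarrow> B \<in> \<B> \<longleftrightarrow> (0 :: real) < sum w B"
    unfolding threshold_matroid_def by auto
  obtain S where "S \<in> \<B>" "\<And>B \<theta>. B \<in> \<B> \<Longrightarrow> cnt (deg \<B>) \<theta> B \<le> cnt (deg \<B>) \<theta> S"
    using greedy_basis_exists[OF M, of "deg \<B>"] by auto
  then interpret degree_threshold E \<B> k w S
    using M w by unfold_locales
  \<comment> \<open>For \<open>k = 0\<close> the empty set is the basis, and its weight 0 is not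
    positive.\<close>
  have "k > 0"
  proof (rule ccontr)
    assume "\<not> k > 0"
    then have "S = {}" using Bk[OF S(1)] fin[OF S(1)] by simp
    then show False using w[OF BE[OF S(1)] Bk[OF S(1)]] S(1) by simp
  qed
  then show "k > 0 \<and> (\<exists>c\<in>{1, k}. swap_closed \<B> (penalty \<B> k c) (max_pen \<B> (penalty \<B> k c)))"
    using swap_closed_penalty by blast
next
  assume "k > 0 \<and> (\<exists>c\<in>{1, k}. swap_closed \<B> (penalty \<B> k c) (max_pen \<B> (penalty \<B> k c)))"
  then obtain c where c: "k > 0" "swap_closed \<B> (penalty \<B> k c) (max_pen \<B> (penalty \<B> k c))" by auto
  have "finite \<B>"
    using M unfolding matroid_of_rank_def matroid_def by (meson PowI finite_Pow_iff finite_subset subsetI)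
  then have "sum (penalty \<B> k c) B \<le> max_pen \<B> (penalty \<B> k c)" if "B \<in> \<B>" for B
    unfolding max_pen_def using that by (intro Max_ge) auto
  then show "threshold_matroid k E \<B>" using threshold_if_swap_closed[OF M c(1)] c(2) by blast
qed

text \<open>Every neighbour of a basis in the basis graph passes the penalty test, so closure under swaps
  amounts to an equality of two counts.\<close>

definition pen_count :: "'a set set \<Rightarrow> ('a \<Rightarrow> nat) \<Rightarrow> nat \<Rightarrow> nat" where
  "pen_count \<B> u T = (\<Sum>B\<in>\<B>. \<Sum>a\<in>B. \<Sum>b\<in>\<Union>\<B>.
     of_bool (deg \<B> a < card \<B> \<and> b \<notin> B \<and> sum u B + u b \<le> T + u a))"

text \<open>Sharing all but one of \<open>k\<close> elements is adjacency in the basis graph, and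
  the size of an intersection is obtained from marks in \<open>k\<close> steps.\<close>

definition adj_count :: "'a set set \<Rightarrow> nat \<Rightarrow> nat" where
  "adj_count \<B> k = (\<Sum>B\<in>\<B>. \<Sum>B'\<in>\<B>. of_bool (card (B' \<inter> B) + 1 = k))"

text \<open>Swaps leading to bases, \<open>Q B\<close>, always pass the test \<open>P B\<close>: the
  new basis has penalty at most \<open>T\<close>, and it avoids \<open>a\<close>, which is thus no
  coloop. Closure is the reverse inclusion, and for finite nested sets equal totals force equality
  basis by basis.\<close>

lemma swap_closed_iff_counts:
  assumes fB: "finite \<B>" and Bk: "\<And>B. B \<in> \<B> \<Longrightarrow> finite B \<and> card B = k"
    and le: "\<And>B. B \<in> \<B> \<Longrightarrow> sum u B \<le> T"
  shows "swap_closed \<B> u T \<longleftrightarrow> pen_count \<B> u T = adj_count \<B> k"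
proof -
  define P where "P B = {(a, b). a \<in> B \<and> b \<in> \<Union>\<B> \<and> b \<notin> B \<and> deg \<B> a < card \<B> \<and> sum u B + u b \<le> T + u a}" for B
  define Q where "Q B = {(a, b). a \<in> B \<and> b \<notin> B \<and> insert b (B - {a}) \<in> \<B>}" for B
  have finU: "finite (\<Union>\<B>)" using fB Bk by blast
  have finP: "finite (P B)" if "B \<in> \<B>" for B
    by (rule finite_subset[of _ "\<Union>\<B> \<times> \<Union>\<B>"]) (use that finU in \<open>auto simp: P_def\<close>)
  have QP: "Q B \<subseteq> P B" if "B \<in> \<B>" for B
  proof clarify
    fix a b assume "(a, b) \<in> Q B"
    then have ab: "a \<in> B" "b \<notin> B" "insert b (B - {a}) \<in> \<B>" by (auto simp: Q_def)
    then have "a \<notin> insert b (B - {a})" by auto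
    then have "deg \<B> a \<noteq> card \<B>" using bspec[OF iffD1[OF deg_eq_card_iff[OF fB, of a]] ab(3)] by argo
    then have "deg \<B> a < card \<B>" using deg_le_card[OF fB, of a] by simp
    moreover have "sum u B + u b \<le> T + u a"
      using sum_swap_nat[of B a b u] le[OF ab(3)] ab Bk that by auto
    ultimately show "(a, b) \<in> P B" using ab unfolding P_def by auto
  qed
  have pc: "pen_count \<B> u T = (\<Sum>B\<in>\<B>. card (P B))"
    unfolding pen_count_def
  proof (rule sum.cong[OF refl])
    fix B assume B: "B \<in> \<B>"
    let ?p = "\<lambda>a b. deg \<B> a < card \<B> \<and> b \<notin> B \<and> sum u B + u b \<le> T + u a"
    have "P B = (SIGMA a:B. {b \<in> \<Union>\<B>. ?p a b})" unfolding P_def by auto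
    moreover have "card \<dots> = (\<Sum>a\<in>B. card {b \<in> \<Union>\<B>. ?p a b})"
      by (intro card_SigmaI) (use Bk[OF B] finU in \<open>simp_all del: Union_iff\<close>)
    ultimately have "card (P B) = (\<Sum>a\<in>B. card {b \<in> \<Union>\<B>. ?p a b})" by simp
    also have "\<dots> = (\<Sum>a\<in>B. \<Sum>b\<in>\<Union>\<B>. of_bool (?p a b))"
      using finU by (simp add: Int_def)
    finally show "(\<Sum>a\<in>B. \<Sum>b\<in>\<Union>\<B>. of_bool (?p a b)) = card (P B)" ..
  qed
  have ac: "adj_count \<B> k = (\<Sum>B\<in>\<B>. card (Q B))"
    unfolding adj_count_def
  proof (rule sum.cong[OF refl])
    fix B assume B: "B \<in> \<B>"
    \<comment> \<open>The differences of the two bases in either direction are the singletons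
      \<open>{a}\<close> and \<open>{b}\<close>, so a swap is recovered from its result.\<close>
    have "bij_betw (\<lambda>(a, b). insert b (B - {a})) (Q B) {B' \<in> \<B>. card (B' \<inter> B) + 1 = k}"
      unfolding bij_betw_def
    proof
      have "B - insert b (B - {a}) = {a}" "insert b (B - {a}) - B = {b}" if "(a, b) \<in> Q B" for a b
        using that unfolding Q_def by auto
      then show "inj_on (\<lambda>(a, b). insert b (B - {a})) (Q B)"
        unfolding inj_on_def by (metis (no_types, lifting) case_prod_conv prod.exhaust singleton_inject)
      show "(\<lambda>(a, b). insert b (B - {a})) ` Q B = {B' \<in> \<B>. card (B' \<inter> B) + 1 = k}"
      proof (intro equalityI subsetI)
        fix B' assume "B' \<in> (\<lambda>(a, b). insert b (B - {a})) ` Q B"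
        then obtain a b where ab: "a \<in> B" "b \<notin> B" "B' \<in> \<B>" "B' = insert b (B - {a})"
          unfolding Q_def by auto
        then have "B' \<inter> B = B - {a}" by auto
        then show "B' \<in> {B' \<in> \<B>. card (B' \<inter> B) + 1 = k}"
          using ab Bk[OF B] by (metis (mono_tags) Suc_eq_plus1 card_Suc_Diff1 mem_Collect_eq)
      next
        fix B' assume "B' \<in> {B' \<in> \<B>. card (B' \<inter> B) + 1 = k}"
        then have B': "B' \<in> \<B>" "card (B' \<inter> B) + 1 = k" by auto
        have "card (B' - B) = 1" "card (B - B') = 1"
          using B' Bk[OF B] Bk[OF B'(1)] card_Int_Diff[of B' B] card_Int_Diff[of B B']
          by (simp_all add: Int_commute)
        then obtain a b where "B' - B = {b}" "B - B' = {a}" by (metis card_1_singletonE)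
        moreover from this have "B' = insert b (B - {a})" by blast
        ultimately show "B' \<in> (\<lambda>(a, b). insert b (B - {a})) ` Q B"
          using B' unfolding Q_def by (intro image_eqI[of _ _ "(a, b)"]) auto
      qed
    qed
    then show "(\<Sum>B'\<in>\<B>. of_bool (card (B' \<inter> B) + 1 = k)) = card (Q B)"
      using fB by (simp add: bij_betw_same_card Int_def)
  qed
  have "swap_closed \<B> u T \<longleftrightarrow> (\<forall>B\<in>\<B>. P B \<subseteq> Q B)"
    unfolding swap_closed_def P_def Q_def by blast
  also have "\<dots> \<longleftrightarrow> (\<forall>B\<in>\<B>. card (P B) = card (Q B))"
    using QP finP by (intro ball_cong refl) (metis card_subset_eq subset_antisym order_refl)
  also have "\<dots> \<longleftrightarrow> (\<Sum>B\<in>\<B>. card (P B)) = (\<Sum>B\<in>\<B>. card (Q B))"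
  proof
    assume eq: "(\<Sum>B\<in>\<B>. card (P B)) = (\<Sum>B\<in>\<B>. card (Q B))"
    show "\<forall>B\<in>\<B>. card (P B) = card (Q B)"
      using sum_mono_inv[OF eq[symmetric]] QP finP fB by (metis card_mono)
  qed auto
  finally show ?thesis using pc ac by simp
qed

section \<open>Timed program logic\<close>

text \<open>A precondition for total correctness: it asserts a halting run and passes its exact time
  to the postcondition.\<close>

definition wpt :: "com \<Rightarrow> (nat \<Rightarrow> state \<Rightarrow> bool) \<Rightarrow> state \<Rightarrow> bool" where
  "wpt c Q s \<longleftrightarrow> (\<exists>t s'. runs c s t s' \<and> Q t s')"

abbreviation setv :: "vname \<Rightarrow> nat \<Rightarrow> state \<Rightarrow> state" where
  "setv x v s \<equiv> s\<lparr>vars := (vars s)(x := v)\<rparr>"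

lemma wpt_Skip: "wpt Skip Q s \<longleftrightarrow> Q 1 s"
  unfolding wpt_def by (metis runs.Skip runs_SkipE)

lemma wpt_Assign: "wpt (Assign x e) Q s \<longleftrightarrow> Q (acost e + 1) (setv x (aval e s) s)"
  unfolding wpt_def by (metis runs.Assign runs_AssignE)

lemma wpt_Write: "wpt (Write a i e) Q s \<longleftrightarrow>
    Q (acost i + acost e + 1) (s\<lparr>arrs := (arrs s)(a := (arrs s a)(aval i s := aval e s))\<rparr>)"
  unfolding wpt_def by (metis runs.Write runs_WriteE)

lemma wpt_Seq: "wpt (Seq c1 c2) Q s \<longleftrightarrow> wpt c1 (\<lambda>t1. wpt c2 (\<lambda>t2. Q (t1 + t2))) s"
  unfolding wpt_def by (blast elim: runs_SeqE intro: runs.Seq)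

lemma wpt_Cond: "wpt (Cond b c1 c2) Q s \<longleftrightarrow>
    (if bval b s then wpt c1 (\<lambda>t. Q (bcost b + 1 + t)) s else wpt c2 (\<lambda>t. Q (bcost b + 1 + t)) s)"
proof
  assume "wpt (Cond b c1 c2) Q s"
  then show "if bval b s then wpt c1 (\<lambda>t. Q (bcost b + 1 + t)) s else wpt c2 (\<lambda>t. Q (bcost b + 1 + t)) s"
    unfolding wpt_def by (auto elim!: runs_CondE)
next
  assume *: "if bval b s then wpt c1 (\<lambda>t. Q (bcost b + 1 + t)) s else wpt c2 (\<lambda>t. Q (bcost b + 1 + t)) s"
  show "wpt (Cond b c1 c2) Q s"
  proof (cases "bval b s")
    case True
    then obtain t s' where "runs c1 s t s'" "Q (bcost b + 1 + t) s'" using * unfolding wpt_def by auto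
    then show ?thesis using runs.CondTrue[OF True] unfolding wpt_def by blast
  next
    case False
    then obtain t s' where "runs c2 s t s'" "Q (bcost b + 1 + t) s'" using * unfolding wpt_def by auto
    then show ?thesis using runs.CondFalse[OF False] unfolding wpt_def by blast
  qed
qed

lemmas wpt_simps = wpt_Skip wpt_Assign wpt_Write wpt_Seq wpt_Cond

lemma wpt_mono: "wpt c Q s \<Longrightarrow> (\<And>t s'. Q t s' \<Longrightarrow> Q' t s') \<Longrightarrow> wpt c Q' s"
  unfolding wpt_def by blast

definition For :: "vname \<Rightarrow> vname \<Rightarrow> com \<Rightarrow> com" where
  "For x v c = Seq (Assign x (Const 0))
     (While (Less (Var x) (Var v)) (Seq c (Assign x (Plus (Var x) (Const 1)))))"

text \<open>The invariant is demanded after the increment, and the body must preserve the counter.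
  Of the 8 units per round, 4 pay for the guard and 4 for the increment; the last 4 pay for the
  failing guard.\<close>

lemma wpt_While:
  assumes "I j s" "vars s x = j" "j \<le> N"
    and body: "\<And>j s. j < N \<Longrightarrow> I j s \<Longrightarrow> vars s x = j \<Longrightarrow>
      wpt c (\<lambda>t s'. t \<le> T \<and> vars s' x = j \<and> I (Suc j) (setv x (Suc j) s')) s"
    and N: "\<And>j s. I j s \<Longrightarrow> vars s v = N"
  shows "wpt (While (Less (Var x) (Var v)) (Seq c (Assign x (Plus (Var x) (Const 1)))))
    (\<lambda>t s'. t \<le> (N - j) * (T + 8) + 4 \<and> I N s') s"
  using assms(1-3)
proof (induction "N - j" arbitrary: j s)
  case 0
  then have "j = N" by simp
  then show ?case
    using 0 N[OF 0(2)] runs.WhileFalse[of "Less (Var x) (Var v)" s] unfolding wpt_def by fastforce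
next
  case (Suc r)
  then have j: "j < N" by simp
  obtain t s' where 1: "runs c s t s'" "t \<le> T" "vars s' x = j" "I (Suc j) (setv x (Suc j) s')"
    using body[OF j Suc.prems(1,2)] unfolding wpt_def by blast
  let ?s = "setv x (Suc j) s'"
  have "wpt (While (Less (Var x) (Var v)) (Seq c (Assign x (Plus (Var x) (Const 1)))))
    (\<lambda>t s'. t \<le> (N - Suc j) * (T + 8) + 4 \<and> I N s') ?s"
    using Suc.hyps(1)[of "Suc j" ?s] Suc.hyps(2) j 1 by simp
  then obtain t' s'' where 2: "runs (While (Less (Var x) (Var v)) (Seq c (Assign x (Plus (Var x) (Const 1))))) ?s t' s''"
    "t' \<le> (N - Suc j) * (T + 8) + 4" "I N s''" unfolding wpt_def by blast
  have "runs (Assign x (Plus (Var x) (Const 1))) s' 4 ?s"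
    using runs.Assign[of x "Plus (Var x) (Const 1)" s'] 1(3) by (simp del: One_nat_def add: Suc_eq_plus1)
  then have "runs (Seq c (Assign x (Plus (Var x) (Const 1)))) s (t + 4) ?s"
    using 1(1) runs.Seq by blast
  then have "runs (While (Less (Var x) (Var v)) (Seq c (Assign x (Plus (Var x) (Const 1))))) s
    (bcost (Less (Var x) (Var v)) + 1 + (t + 4) + t') s''"
    using 2(1) j Suc.prems N[OF Suc.prems(1)] by (intro runs.WhileTrue) auto
  moreover have "N - j = Suc (N - Suc j)" using j by simp
  then have "bcost (Less (Var x) (Var v)) + 1 + (t + 4) + t' \<le> (N - j) * (T + 8) + 4"
    using 1(2) 2(2) by simp
  ultimately show ?case unfolding wpt_def using 2(3) by blast
qed

lemma wpt_For:
  assumes "I 0 (setv x 0 s)"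
    and "\<And>j s. I j s \<Longrightarrow> vars s v = N"
    and "\<And>j s. j < N \<Longrightarrow> I j s \<Longrightarrow> vars s x = j \<Longrightarrow>
      wpt c (\<lambda>t s'. t \<le> T \<and> vars s' x = j \<and> I (Suc j) (setv x (Suc j) s')) s"
    and "\<And>t s'. t \<le> N * (T + 8) + 6 \<Longrightarrow> I N s' \<Longrightarrow> Q t s'"
  shows "wpt (For x v c) Q s"
  unfolding For_def wpt_Seq wpt_Assign
  by (rule wpt_mono[OF wpt_While[of I 0 _ x N c T v]]) (use assms in auto)

text \<open>A frame condition: \<open>V\<close> and \<open>A\<close> name the variables and arrays
  that may have changed.\<close>

definition agree :: "vname set \<Rightarrow> vname set \<Rightarrow> state \<Rightarrow> state \<Rightarrow> bool" where
  "agree V A s s' \<longleftrightarrow> (\<forall>x. x \<notin> V \<longrightarrow> vars s' x = vars s x) \<and> (\<forall>a. a \<notin> A \<longrightarrow> arrs s' a = arrs s a)"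

lemma agree_var: "agree V A s s' \<Longrightarrow> x \<notin> V \<Longrightarrow> vars s' x = vars s x"
  and agree_arr: "agree V A s s' \<Longrightarrow> a \<notin> A \<Longrightarrow> arrs s' a = arrs s a"
  unfolding agree_def by auto

lemma agree_trans: "agree V A s s' \<Longrightarrow> agree V' A' s' s'' \<Longrightarrow> V \<subseteq> W \<Longrightarrow> V' \<subseteq> W \<Longrightarrow> A \<subseteq> X \<Longrightarrow> A' \<subseteq> X \<Longrightarrow> agree W X s s''"
  unfolding agree_def by (metis subsetD)

lemma agree_setv: "x \<in> V \<Longrightarrow> agree V A s (setv x v s') \<longleftrightarrow> agree V A s s'"
  unfolding agree_def by auto

lemma agree_seta: "a \<in> A \<Longrightarrow> agree V A s (s'\<lparr>arrs := (arrs s')(a := f)\<rparr>) \<longleftrightarrow> agree V A s s'"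
  unfolding agree_def by auto

lemma agree_refl: "agree V A s s"
  unfolding agree_def by auto

lemmas agree_simps = agree_setv agree_seta agree_refl

section \<open>The algorithm\<close>

abbreviation entry :: "vname \<Rightarrow> vname \<Rightarrow> aexp" where
  "entry off j \<equiv> Read ''bases'' (Plus (Var off) (Var j))"

abbreviation incr :: "vname \<Rightarrow> com" where
  "incr x \<equiv> Assign x (Plus (Var x) (Const 1))"

text \<open>The machine has no multiplication, so \<open>m * k\<close> is obtained by
  \<open>m\<close> additions.\<close>

definition "c_len = For ''i'' ''m'' (Assign ''len'' (Plus (Var ''len'') (Var ''k'')))"

text \<open>A zero degree reveals a first occurrence, so \<open>elems\<close> collects every nonloop
  once and the rest of the ground set is never touched.\<close>

definition "c_deg = For ''p'' ''len''
  (Seq (Cond (Equal (Read ''deg'' (Read ''bases'' (Var ''p''))) (Const 0))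
         (Seq (Write ''elems'' (Var ''ne'') (Read ''bases'' (Var ''p''))) (incr ''ne'')) Skip)
       (Write ''deg'' (Read ''bases'' (Var ''p'')) (Plus (Read ''deg'' (Read ''bases'' (Var ''p''))) (Const 1))))"

definition "c_ext = Seq (Assign ''mn'' (Var ''m'')) (Seq (Assign ''mx'' (Const 0)) (For ''p'' ''len''
  (Seq (Assign ''x'' (Read ''deg'' (Read ''bases'' (Var ''p''))))
   (Seq (Cond (Less (Var ''x'') (Var ''mn'')) (Assign ''mn'' (Var ''x'')) Skip)
     (Cond (Conj (Less (Var ''x'') (Var ''m'')) (Less (Var ''mx'') (Var ''x''))) (Assign ''mx'' (Var ''x'')) Skip)))))"

text \<open>Marks are time stamps, so they never have to be cleared.\<close>

definition "c_mark = Seq (incr ''st'') (For ''j'' ''k'' (Write ''mark'' (entry ''off'' ''j'') (Var ''st'')))"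

definition "c_cnt = Seq (Assign ''cnt'' (Const 0)) (For ''j'' ''k''
  (Cond (Equal (Read ''mark'' (entry ''off2'' ''j'')) (Var ''st'')) (incr ''cnt'') Skip))"

definition "c_row = Seq (Assign ''off2'' (Const 0)) (For ''h'' ''m'' (Seq c_cnt
  (Seq (Cond (Equal (Plus (Var ''cnt'') (Const 1)) (Var ''k'')) (incr ''adj'') Skip)
    (Assign ''off2'' (Plus (Var ''off2'') (Var ''k''))))))"

definition "c_adj = Seq (Assign ''off'' (Const 0)) (For ''i'' ''m'' (Seq c_mark (Seq c_row
  (Assign ''off'' (Plus (Var ''off'') (Var ''k''))))))"

definition "c_pen = For ''p'' ''len''
  (Cond (Equal (Read ''deg'' (Read ''bases'' (Var ''p''))) (Var ''mn''))
    (Write ''pen'' (Read ''bases'' (Var ''p'')) (Plus (Var ''k'') (Const 1)))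
    (Cond (Equal (Read ''deg'' (Read ''bases'' (Var ''p''))) (Var ''mx''))
      (Write ''pen'' (Read ''bases'' (Var ''p'')) (Const 0))
      (Write ''pen'' (Read ''bases'' (Var ''p'')) (Var ''c''))))"

definition "c_sum = Seq (Assign ''sum'' (Const 0)) (For ''j'' ''k''
  (Assign ''sum'' (Plus (Var ''sum'') (Read ''pen'' (entry ''off'' ''j'')))))"

definition "c_max = Seq (Assign ''T'' (Const 0)) (Seq (Assign ''off'' (Const 0)) (For ''i'' ''m'' (Seq c_sum
  (Seq (Cond (Less (Var ''T'') (Var ''sum'')) (Assign ''T'' (Var ''sum'')) Skip)
    (Assign ''off'' (Plus (Var ''off'') (Var ''k'')))))))"

text \<open>The inequality has sums on both sides because machine subtraction is truncated.\<close>

definition "c_swaps = For ''q'' ''ne''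
  (Cond (Conj (Neg (Equal (Read ''mark'' (Read ''elems'' (Var ''q''))) (Var ''st'')))
      (Neg (Less (Plus (Var ''T'') (Read ''pen'' (entry ''off'' ''j'')))
         (Plus (Var ''sum'') (Read ''pen'' (Read ''elems'' (Var ''q'')))))))
    (incr ''tot'') Skip)"

definition "c_basis = For ''j'' ''k''
  (Cond (Less (Read ''deg'' (entry ''off'' ''j'')) (Var ''m'')) c_swaps Skip)"

definition "c_tot = Seq (Assign ''tot'' (Const 0)) (Seq (Assign ''off'' (Const 0)) (For ''i'' ''m''
  (Seq c_mark (Seq c_sum (Seq c_basis (Assign ''off'' (Plus (Var ''off'') (Var ''k''))))))))"

text \<open>\<open>result\<close> is only ever set to 1, so two runs compute the disjunction over
  both candidates.\<close>

definition "c_try = Seq c_pen (Seq c_max (Seq c_tot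
  (Cond (Equal (Var ''tot'') (Var ''adj'')) (Assign ''result'' (Const 1)) Skip)))"

text \<open>Initially \<open>result\<close> is 0, which is already the answer for
  \<open>k = 0\<close>. The count \<open>adj\<close> does not depend on \<open>c\<close> and is
  computed once.\<close>

definition "c_main = Cond (Equal (Var ''k'') (Const 0)) Skip
  (Seq c_len (Seq c_deg (Seq c_ext (Seq c_adj
    (Seq (Assign ''c'' (Const 1)) (Seq c_try (Seq (Assign ''c'' (Var ''k'')) c_try)))))))"

section \<open>Correctness and running time of the subroutines\<close>

locale basis_list =
  fixes k :: nat and Bs :: "nat list list"
  assumes k: "k > 0"
    and Bs: "\<And>b. b \<in> set Bs \<Longrightarrow> length b = k \<and> distinct b" "distinct (map set Bs)" "Bs \<noteq> []"
begin

abbreviation m where "m \<equiv> length Bs"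
abbreviation cs where "cs \<equiv> concat Bs"

lemma m: "m > 0" using Bs by simp

lemma concat_nth_block:
  assumes "\<And>b. b \<in> set xs \<Longrightarrow> length b = k" "i < length xs" "j < k"
  shows "concat xs ! (i * k + j) = xs ! i ! j"
  using assms
proof (induction xs arbitrary: i)
  case (Cons x xs)
  then show ?case by (cases i) (auto simp: nth_append)
qed simp

lemma length_concat_block:
  assumes "\<And>b. b \<in> set xs \<Longrightarrow> length b = k"
  shows "length (concat xs) = length xs * k"
  using assms by (induction xs) auto

lemma length_cs: "length cs = m * k"
  using length_concat_block Bs by blast

lemma index_less: "i < m \<Longrightarrow> j < k \<Longrightarrow> i * k + j < m * k"
  using k by (metis mult.commute mult_Suc_right add.commute add_less_mono1 less_le_trans mult_le_mono2 Suc_leI)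

lemma cs_nth: "i < m \<Longrightarrow> j < k \<Longrightarrow> cs ! (i * k + j) = Bs ! i ! j"
  using concat_nth_block Bs by blast

lemma length_nth: "i < m \<Longrightarrow> length (Bs ! i) = k"
  using Bs by simp

definition inp :: "state \<Rightarrow> bool" where
  "inp s \<longleftrightarrow> vars s ''k'' = k \<and> vars s ''m'' = m \<and> vars s ''len'' = m * k \<and>
     (\<forall>p<m * k. arrs s ''bases'' p = cs ! p)"

lemma inpD:
  assumes "inp s"
  shows "vars s ''k'' = k" "vars s ''m'' = m" "vars s ''len'' = m * k"
    "p < m * k \<Longrightarrow> arrs s ''bases'' p = cs ! p"
    "i < m \<Longrightarrow> j < k \<Longrightarrow> arrs s ''bases'' (i * k + j) = Bs ! i ! j"
  using assms cs_nth index_less unfolding inp_def by auto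

lemma inp_agree:
  assumes "agree V A s s'" "''k'' \<notin> V" "''m'' \<notin> V" "''len'' \<notin> V" "''bases'' \<notin> A" "inp s"
  shows "inp s'"
  using assms unfolding inp_def agree_def by metis

lemma mark_spec:
  assumes "inp s" "i < m" "vars s ''off'' = i * k" "\<And>x. arrs s ''mark'' x \<le> vars s ''st''"
  shows "wpt c_mark (\<lambda>t s'. t \<le> 24 * k \<and> agree {''st'', ''j''} {''mark''} s s' \<and>
    (\<forall>x. arrs s' ''mark'' x \<le> vars s' ''st'') \<and>
    (\<forall>x. arrs s' ''mark'' x = vars s' ''st'' \<longleftrightarrow> x \<in> set (Bs ! i))) s"
  unfolding c_mark_def wpt_Seq wpt_Assign
proof (rule wpt_For[where N = k and T = 6 and
    I = "\<lambda>j s'. agree {''st'', ''j''} {''mark''} s s' \<and> vars s' ''st'' = Suc (vars s ''st'') \<and>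
      (\<forall>x. arrs s' ''mark'' x = (if x \<in> set (take j (Bs ! i)) then Suc (vars s ''st'') else arrs s ''mark'' x))"], goal_cases)
  case (2 j s')
  then have ag: "agree {''st'', ''j''} {''mark''} s s'" by blast
  show ?case using agree_var[OF ag] inpD[OF assms(1)] by simp
next
  case (3 j s')
  then have ag: "agree {''st'', ''j''} {''mark''} s s'" by blast
  have "inp s'" using inp_agree[OF ag] assms(1) by simp
  moreover have "take (Suc j) (Bs ! i) = take j (Bs ! i) @ [Bs ! i ! j]"
    using 3 length_nth[OF assms(2)] by (simp add: take_Suc_conv_app_nth)
  ultimately show ?case
    using 3 assms(2,3) agree_var[OF ag] by (auto simp: wpt_simps agree_simps inpD)
next
  case (4 t s')
  \<comment> \<open>The new stamp exceeds every old one, so a cell carries it exactly if this loop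
    wrote it.\<close>
  have "arrs s ''mark'' x \<noteq> Suc (vars s ''st'')" "arrs s ''mark'' x \<le> Suc (vars s ''st'')" for x
    using assms(4)[of x] by simp_all
  then show ?case using 4 k length_nth[OF assms(2)] by simp
qed (use assms in \<open>simp add: agree_def\<close>)

lemma cnt_spec:
  assumes "inp s" "h < m" "vars s ''off2'' = h * k"
  shows "wpt c_cnt (\<lambda>t s'. t \<le> 40 * k \<and> agree {''cnt'', ''j''} {} s s' \<and>
    vars s' ''cnt'' = (\<Sum>j<k. of_bool (arrs s ''mark'' (Bs ! h ! j) = vars s ''st''))) s"
  unfolding c_cnt_def wpt_Seq wpt_Assign
proof (rule wpt_For[where N = k and T = 20 and
    I = "\<lambda>j s'. agree {''cnt'', ''j''} {} s s' \<and>
      vars s' ''cnt'' = (\<Sum>j<j. of_bool (arrs s ''mark'' (Bs ! h ! j) = vars s ''st''))"], goal_cases)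
  case (2 j s')
  then have ag: "agree {''cnt'', ''j''} {} s s'" by blast
  show ?case using agree_var[OF ag] inpD[OF assms(1)] by simp
next
  case (3 j s')
  then have ag: "agree {''cnt'', ''j''} {} s s'" by blast
  have "inp s'" using inp_agree[OF ag] assms(1) by simp
  then show ?case
    using 3 assms(2,3)
    by (simp add: wpt_simps agree_simps agree_var[OF ag] agree_arr[OF ag] inpD[OF assms(1)])
next
  case (4 t s')
  then show ?case using k by simp
qed (use assms in \<open>simp add: agree_def\<close>)

lemma sum_spec:
  assumes "inp s" "i < m" "vars s ''off'' = i * k"
  shows "wpt c_sum (\<lambda>t s'. t \<le> 40 * k \<and> agree {''sum'', ''j''} {} s s' \<and>
    vars s' ''sum'' = (\<Sum>j<k. arrs s ''pen'' (Bs ! i ! j))) s"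
  unfolding c_sum_def wpt_Seq wpt_Assign
proof (rule wpt_For[where N = k and T = 20 and
    I = "\<lambda>j s'. agree {''sum'', ''j''} {} s s' \<and>
      vars s' ''sum'' = (\<Sum>j<j. arrs s ''pen'' (Bs ! i ! j))"], goal_cases)
  case (2 j s')
  then have ag: "agree {''sum'', ''j''} {} s s'" by blast
  show ?case using agree_var[OF ag] inpD[OF assms(1)] by simp
next
  case (3 j s')
  then have ag: "agree {''sum'', ''j''} {} s s'" by blast
  have "inp s'" using inp_agree[OF ag] assms(1) by simp
  then show ?case
    using 3 assms(2,3)
    by (simp add: wpt_simps agree_simps agree_var[OF ag] agree_arr[OF ag] inpD[OF assms(1)])
next
  case (4 t s')
  then show ?case using k by simp
qed (use assms in \<open>simp add: agree_def\<close>)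

end

lemma sum_nth_distinct: "distinct xs \<Longrightarrow> (\<Sum>i<length xs. f (xs ! i)) = sum f (set xs)"
  by (simp add: sum.distinct_set_conv_list sum_list_sum_nth atLeast0LessThan)

context basis_list
begin

text \<open>These absorb lower-order terms of loop costs into the leading product; the stated time
  constants are generous for this purpose.\<close>

lemma sizes: "1 \<le> k" "k \<le> m * k" "m \<le> m * k" "1 \<le> m * k"
  using k m by (auto simp: Suc_le_eq)

lemma sum_block: "i < m \<Longrightarrow> (\<Sum>j<k. f (Bs ! i ! j)) = sum f (set (Bs ! i))"
  using Bs(1)[of "Bs ! i"] sum_nth_distinct[of "Bs ! i" f] by simp

text \<open>Since each basis is listed once, a loop over the list sums over the set system.\<close>

lemma sum_bases: "(\<Sum>i<m. f (set (Bs ! i))) = sum f (set (map set Bs))"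
  using sum_nth_distinct[OF Bs(2), of f] by (simp only: length_map) simp

lemma row_spec:
  assumes "inp s" "i < m" "\<And>x. arrs s ''mark'' x = vars s ''st'' \<longleftrightarrow> x \<in> set (Bs ! i)"
  shows "wpt c_row (\<lambda>t s'. t \<le> 100 * (m * k) \<and> agree {''cnt'', ''j'', ''adj'', ''off2'', ''h''} {} s s' \<and>
    vars s' ''adj'' = vars s ''adj'' + (\<Sum>h<m. of_bool (card (set (Bs ! h) \<inter> set (Bs ! i)) + 1 = k))) s"
  unfolding c_row_def wpt_Seq wpt_Assign
proof (rule wpt_For[where N = m and T = "40 * k + 30" and
    I = "\<lambda>h s'. agree {''cnt'', ''j'', ''adj'', ''off2'', ''h''} {} s s' \<and> vars s' ''off2'' = h * k \<and>
      vars s' ''adj'' = vars s ''adj'' + (\<Sum>h<h. of_bool (card (set (Bs ! h) \<inter> set (Bs ! i)) + 1 = k))"], goal_cases)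
  case (2 h s')
  then have ag: "agree {''cnt'', ''j'', ''adj'', ''off2'', ''h''} {} s s'" by blast
  show ?case using agree_var[OF ag] inpD[OF assms(1)] by simp
next
  case (3 h s')
  then have ag: "agree {''cnt'', ''j'', ''adj'', ''off2'', ''h''} {} s s'" by blast
  have inp': "inp s'" using inp_agree[OF ag] assms(1) by simp
  show ?case unfolding wpt_Seq
  proof (rule wpt_mono[OF cnt_spec[OF inp' \<open>h < m\<close>]], goal_cases)
    case (2 t1 s1)
    then have ag1: "agree {''cnt'', ''j''} {} s' s1" by blast
    have ag2: "agree {''cnt'', ''j'', ''adj'', ''off2'', ''h''} {} s s1"
      by (rule agree_trans[OF ag ag1]) auto
    have "vars s1 ''cnt'' = (\<Sum>j<k. of_bool (Bs ! h ! j \<in> set (Bs ! i)))"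
      using 2 assms(3) agree_var[OF ag] agree_arr[OF ag] by simp
    also have "\<dots> = card (set (Bs ! h) \<inter> set (Bs ! i))"
      using \<open>h < m\<close> by (subst sum_block) (simp_all add: Int_def)
    finally show ?case
      using 2 \<open>agree _ _ s s' \<and> _\<close> \<open>vars s' ''h'' = h\<close> ag2
      by (simp add: wpt_simps agree_def agree_var[OF ag1] inpD[OF inp'])
  qed (use 3 in auto)
next
  case (4 t s')
  have "t \<le> m * (40 * k + 30 + 8) + 6" using 4 by simp
  also have "\<dots> = 40 * (m * k) + 38 * m + 6" by (simp add: algebra_simps)
  finally have "2 + t \<le> 100 * (m * k)" using sizes by linarith
  then show ?case using 4 by simp
qed (use assms in \<open>simp add: agree_def\<close>)

lemma adj_spec:
  assumes "inp s" "vars s ''adj'' = 0" "\<And>x. arrs s ''mark'' x \<le> vars s ''st''"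
  shows "wpt c_adj (\<lambda>t s'. t \<le> 200 * (m * (m * k)) \<and>
    agree {''st'', ''cnt'', ''j'', ''adj'', ''off2'', ''h'', ''off'', ''i''} {''mark''} s s' \<and>
    (\<forall>x. arrs s' ''mark'' x \<le> vars s' ''st'') \<and> vars s' ''adj'' = adj_count (set (map set Bs)) k) s"
  unfolding c_adj_def wpt_Seq wpt_Assign
proof (rule wpt_For[where N = m and T = "24 * k + 100 * (m * k) + 10" and
    I = "\<lambda>i s'. agree {''st'', ''cnt'', ''j'', ''adj'', ''off2'', ''h'', ''off'', ''i''} {''mark''} s s' \<and>
      vars s' ''off'' = i * k \<and> (\<forall>x. arrs s' ''mark'' x \<le> vars s' ''st'') \<and>
      vars s' ''adj'' = (\<Sum>i<i. \<Sum>h<m. of_bool (card (set (Bs ! h) \<inter> set (Bs ! i)) + 1 = k))"], goal_cases)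
  case (2 i s')
  then have ag: "agree {''st'', ''cnt'', ''j'', ''adj'', ''off2'', ''h'', ''off'', ''i''} {''mark''} s s'" by blast
  show ?case using agree_var[OF ag] inpD[OF assms(1)] by simp
next
  case (3 i s')
  then have ag: "agree {''st'', ''cnt'', ''j'', ''adj'', ''off2'', ''h'', ''off'', ''i''} {''mark''} s s'" by blast
  have inp': "inp s'" using inp_agree[OF ag] assms(1) by simp
  show ?case unfolding wpt_Seq
  proof (rule wpt_mono[OF mark_spec[OF inp' \<open>i < m\<close>]], goal_cases)
    case (3 t1 s1)
    then have ag1: "agree {''st'', ''j''} {''mark''} s' s1" by blast
    have inp1: "inp s1" using inp_agree[OF ag1] inp' by simp
    show ?case
    proof (rule wpt_mono[OF row_spec[OF inp1 \<open>i < m\<close>]], goal_cases)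
      case (2 t2 s2)
      then have ag2: "agree {''cnt'', ''j'', ''adj'', ''off2'', ''h''} {} s1 s2" by blast
      have ag3: "agree {''st'', ''cnt'', ''j'', ''adj'', ''off2'', ''h'', ''off'', ''i''} {''mark''} s' s2"
        by (rule agree_trans[OF ag1 ag2]) auto
      have ag4: "agree {''st'', ''cnt'', ''j'', ''adj'', ''off2'', ''h'', ''off'', ''i''} {''mark''} s s2"
        by (rule agree_trans[OF ag ag3]) auto
      show ?case
        using 2 3 \<open>agree _ _ s s' \<and> _\<close> \<open>vars s' ''i'' = i\<close> ag4
        by (simp add: wpt_simps agree_simps agree_var[OF ag1] agree_var[OF ag2] agree_arr[OF ag2] inpD[OF inp'])
    qed (use 3 in auto)
  qed (use 3 in auto)
next
  case (4 t s')
  have "t \<le> m * (24 * k + 100 * (m * k) + 10 + 8) + 6" using 4 by simp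
  also have "\<dots> = 24 * (m * k) + 100 * (m * (m * k)) + 18 * m + 6" by (simp add: algebra_simps)
  finally have "2 + t \<le> 200 * (m * (m * k))"
    using sizes mult_le_mono2[OF sizes(2), of m] by linarith
  moreover have "vars s' ''adj'' = adj_count (set (map set Bs)) k"
    using 4 unfolding adj_count_def
    by (simp only: sum_bases[symmetric])
  ultimately show ?case using 4 by simp
qed (use assms in \<open>simp add: agree_def\<close>)

lemma len_spec:
  assumes "vars s ''k'' = k" "vars s ''m'' = m" "vars s ''len'' = 0" "\<And>p. p < m * k \<Longrightarrow> arrs s ''bases'' p = cs ! p"
  shows "wpt c_len (\<lambda>t s'. t \<le> 20 * (m * k) \<and> agree {''len'', ''i''} {} s s' \<and> inp s') s"
  unfolding c_len_def
proof (rule wpt_For[where N = m and T = 4 and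
    I = "\<lambda>i s'. agree {''len'', ''i''} {} s s' \<and> vars s' ''len'' = i * k"], goal_cases)
  case (2 i s')
  then have ag: "agree {''len'', ''i''} {} s s'" by blast
  show ?case using agree_var[OF ag] assms by simp
next
  case (3 i s')
  then have ag: "agree {''len'', ''i''} {} s s'" by blast
  show ?case using 3 assms agree_var[OF ag] by (simp add: wpt_simps agree_simps)
next
  case (4 t s')
  then have ag: "agree {''len'', ''i''} {} s s'" by blast
  have "inp s'" unfolding inp_def using 4 assms agree_var[OF ag] agree_arr[OF ag] by simp
  moreover have "t \<le> 12 * m + 6" using 4 by simp
  then have "t \<le> 20 * (m * k)" using sizes by linarith
  ultimately show ?case using ag by simp
qed (use assms in \<open>simp add: agree_def\<close>)

lemma set_take_Suc: "p < m * k \<Longrightarrow> set (take (Suc p) cs) = insert (cs ! p) (set (take p cs))"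
  using length_cs by (simp add: take_Suc_conv_app_nth)

lemma deg_spec:
  assumes "inp s" "vars s ''ne'' = 0" "\<And>x. arrs s ''deg'' x = 0"
  shows "wpt c_deg (\<lambda>t s'. t \<le> 50 * (m * k) \<and> agree {''p'', ''ne''} {''deg'', ''elems''} s s' \<and>
    (\<forall>x. arrs s' ''deg'' x = count_list cs x) \<and>
    (\<exists>es. distinct es \<and> set es = set cs \<and> vars s' ''ne'' = length es \<and>
      (\<forall>q<length es. arrs s' ''elems'' q = es ! q))) s"
  unfolding c_deg_def
proof (rule wpt_For[where N = "m * k" and T = 30 and
    I = "\<lambda>p s'. agree {''p'', ''ne''} {''deg'', ''elems''} s s' \<and>
    (\<forall>x. arrs s' ''deg'' x = count_list (take p cs) x) \<and>
    (\<exists>es. distinct es \<and> set es = set (take p cs) \<and> vars s' ''ne'' = length es \<and>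
      (\<forall>q<length es. arrs s' ''elems'' q = es ! q))"], goal_cases)
  case (2 p s')
  then have ag: "agree {''p'', ''ne''} {''deg'', ''elems''} s s'" by blast
  show ?case using agree_var[OF ag] inpD[OF assms(1)] by simp
next
  case (3 p s')
  then have ag: "agree {''p'', ''ne''} {''deg'', ''elems''} s s'" by blast
  have tk: "take (Suc p) cs = take p cs @ [cs ! p]"
    using 3 length_cs by (simp add: take_Suc_conv_app_nth)
  have b: "arrs s' ''bases'' p = cs ! p" using agree_arr[OF ag] inpD[OF assms(1)] 3 by simp
  obtain es where es: "distinct es" "set es = set (take p cs)" "vars s' ''ne'' = length es"
      "\<And>q. q < length es \<Longrightarrow> arrs s' ''elems'' q = es ! q" using 3 by blast
  show ?case
  \<comment> \<open>The degree cell doubles as a visited flag: it is zero exactly if the element is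
    new to the prefix, and only then \<open>es\<close> grows.\<close>
  proof (cases "cs ! p \<in> set (take p cs)")
    case True
    then have "count_list (take p cs) (cs ! p) \<noteq> 0" by (simp add: count_list_0_iff)
    then show ?thesis
      using 3 b True es unfolding tk
      by (auto simp: wpt_simps agree_def insert_absorb intro!: exI[of _ es])
  next
    case False
    then have "count_list (take p cs) (cs ! p) = 0" by (simp add: count_list_0_iff)
    then show ?thesis
      using 3 b False es unfolding tk
      by (auto simp: wpt_simps agree_def nth_append less_Suc_eq intro!: exI[of _ "es @ [cs ! p]"])
  qed
next
  case (4 t s')
  have "t \<le> 38 * (m * k) + 6" using 4 by simp
  then have "t \<le> 50 * (m * k)" using sizes by linarith
  then show ?case using 4 length_cs by simp
qed (use assms in \<open>simp_all add: agree_def\<close>)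

lemma ext_spec:
  assumes "inp s"
  shows "wpt c_ext (\<lambda>t s'. t \<le> 50 * (m * k) \<and> agree {''p'', ''mn'', ''mx'', ''x''} {} s s' \<and>
    vars s' ''mn'' = Min (insert m (arrs s ''deg'' ` set cs)) \<and>
    vars s' ''mx'' = Max (insert 0 {x \<in> arrs s ''deg'' ` set cs. x < m})) s"
  unfolding c_ext_def wpt_Seq wpt_Assign
proof (rule wpt_For[where N = "m * k" and T = 30 and
    I = "\<lambda>p s'. agree {''p'', ''mn'', ''mx'', ''x''} {} s s' \<and>
    vars s' ''mn'' = Min (insert m (arrs s ''deg'' ` set (take p cs))) \<and>
    vars s' ''mx'' = Max (insert 0 {x \<in> arrs s ''deg'' ` set (take p cs). x < m})"], goal_cases)
  case (2 p s')
  then have ag: "agree {''p'', ''mn'', ''mx'', ''x''} {} s s'" by blast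
  show ?case using agree_var[OF ag] inpD[OF assms(1)] by simp
next
  case (3 p s')
  then have ag: "agree {''p'', ''mn'', ''mx'', ''x''} {} s s'" by blast
  let ?D = "arrs s ''deg'' ` set (take p cs)" and ?x = "arrs s ''deg'' (cs ! p)"
  have mn: "Min (insert m (arrs s ''deg'' ` set (take (Suc p) cs))) = min ?x (Min (insert m ?D))"
    unfolding set_take_Suc[OF 3(1)] by (subst image_insert, subst insert_commute, subst Min_insert) auto
  have "{x \<in> insert ?x ?D. x < m} = (if ?x < m then insert ?x {x \<in> ?D. x < m} else {x \<in> ?D. x < m})"
    by auto
  then have mx: "Max (insert 0 {x \<in> arrs s ''deg'' ` set (take (Suc p) cs). x < m}) =
      (if ?x < m then max ?x (Max (insert 0 {x \<in> ?D. x < m})) else Max (insert 0 {x \<in> ?D. x < m}))"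
    unfolding set_take_Suc[OF 3(1)] image_insert by (simp add: insert_commute[of 0 ?x])
  define A where "A = Min (insert m ?D)"
  define X where "X = Max (insert 0 {x \<in> ?D. x < m})"
  have "vars s' ''mn'' = A" "vars s' ''mx'' = X" using 3 unfolding A_def X_def by blast+
  then show ?case
    unfolding mn mx A_def[symmetric] X_def[symmetric] using 3(1,3) ag
    by (simp add: wpt_simps agree_def inpD[OF assms] min_def max_def)
next
  case (4 t s')
  have "t \<le> 38 * (m * k) + 6" using 4 by simp
  then have "2 + (2 + t) \<le> 50 * (m * k)" using sizes by linarith
  then show ?case using 4 length_cs by simp
qed (use assms inpD[OF assms] in \<open>simp add: agree_def\<close>)

lemma pen_spec:
  assumes "inp s"
  shows "wpt c_pen (\<lambda>t s'. t \<le> 50 * (m * k) \<and> agree {''p''} {''pen''} s s' \<and>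
    (\<forall>x\<in>set cs. arrs s' ''pen'' x = (if arrs s ''deg'' x = vars s ''mn'' then k + 1
       else if arrs s ''deg'' x = vars s ''mx'' then 0 else vars s ''c''))) s"
  unfolding c_pen_def
proof (rule wpt_For[where N = "m * k" and T = 30 and
    I = "\<lambda>p s'. agree {''p''} {''pen''} s s' \<and>
    (\<forall>x\<in>set (take p cs). arrs s' ''pen'' x = (if arrs s ''deg'' x = vars s ''mn'' then k + 1
       else if arrs s ''deg'' x = vars s ''mx'' then 0 else vars s ''c''))"], goal_cases)
  case (2 p s')
  then have ag: "agree {''p''} {''pen''} s s'" by blast
  show ?case using agree_var[OF ag] inpD[OF assms(1)] by simp
next
  case (3 p s')
  then have ag: "agree {''p''} {''pen''} s s'" by blast
  show ?case
    unfolding set_take_Suc[OF 3(1)] using 3(1,3) conjunct2[OF 3(2)]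
    by (simp add: wpt_simps agree_simps ag agree_var[OF ag] agree_arr[OF ag] inpD[OF assms])
next
  case (4 t s')
  have "t \<le> 38 * (m * k) + 6" using 4 by simp
  then have "t \<le> 50 * (m * k)" using sizes by linarith
  then show ?case using 4 length_cs by simp
qed (use assms in \<open>simp add: agree_def\<close>)

lemma max_spec:
  assumes "inp s"
  shows "wpt c_max (\<lambda>t s'. t \<le> 100 * (m * k) \<and> agree {''T'', ''off'', ''i'', ''sum'', ''j''} {} s s' \<and>
    vars s' ''T'' = Max (insert 0 ((\<lambda>i. \<Sum>j<k. arrs s ''pen'' (Bs ! i ! j)) ` {..<m}))) s"
  unfolding c_max_def wpt_Seq wpt_Assign
proof (rule wpt_For[where N = m and T = "40 * k + 30" and
    I = "\<lambda>i s'. agree {''T'', ''off'', ''i'', ''sum'', ''j''} {} s s' \<and> vars s' ''off'' = i * k \<and>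
    vars s' ''T'' = Max (insert 0 ((\<lambda>i. \<Sum>j<k. arrs s ''pen'' (Bs ! i ! j)) ` {..<i}))"], goal_cases)
  case (2 i s')
  then have ag: "agree {''T'', ''off'', ''i'', ''sum'', ''j''} {} s s'" by blast
  show ?case using agree_var[OF ag] inpD[OF assms(1)] by simp
next
  case (3 i s')
  then have ag: "agree {''T'', ''off'', ''i'', ''sum'', ''j''} {} s s'" by blast
  have inp': "inp s'" using inp_agree[OF ag] assms(1) by simp
  let ?f = "\<lambda>i. \<Sum>j<k. arrs s ''pen'' (Bs ! i ! j)"
  have mx: "Max (insert 0 (?f ` {..<Suc i})) = max (?f i) (Max (insert 0 (?f ` {..<i})))"
    unfolding lessThan_Suc image_insert by (subst insert_commute, subst Max_insert) auto
  show ?case unfolding wpt_Seq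
  proof (rule wpt_mono[OF sum_spec[OF inp' \<open>i < m\<close>]], goal_cases)
    case (2 t1 s1)
    then have ag1: "agree {''sum'', ''j''} {} s' s1" by blast
    have ag2: "agree {''T'', ''off'', ''i'', ''sum'', ''j''} {} s s1"
      by (rule agree_trans[OF ag ag1]) auto
    show ?case
      unfolding mx
      using 2 \<open>agree _ _ s s' \<and> _\<close> \<open>vars s' ''i'' = i\<close> ag2
      by (simp add: wpt_simps agree_def agree_var[OF ag1] agree_arr[OF ag] inpD[OF inp'] max_def
        del: Max_less_iff)
  qed (use 3 in auto)
next
  case (4 t s')
  have "t \<le> m * (40 * k + 30 + 8) + 6" using 4 by simp
  also have "\<dots> = 40 * (m * k) + 38 * m + 6" by (simp add: algebra_simps)
  finally have "2 + (2 + t) \<le> 100 * (m * k)" using sizes by linarith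
  then show ?case using 4 by simp
qed (use assms in \<open>simp add: agree_def\<close>)

lemma swaps_spec:
  assumes "inp s" "i < m" "j < k" "vars s ''off'' = i * k" "vars s ''j'' = j"
    and "vars s ''ne'' = length es" "\<And>q. q < length es \<Longrightarrow> arrs s ''elems'' q = es ! q"
  shows "wpt c_swaps (\<lambda>t s'. t \<le> 40 * (length es + 1) \<and> agree {''q'', ''tot''} {} s s' \<and>
    vars s' ''tot'' = vars s ''tot'' + (\<Sum>q<length es. of_bool (arrs s ''mark'' (es ! q) \<noteq> vars s ''st'' \<and>
      vars s ''sum'' + arrs s ''pen'' (es ! q) \<le> vars s ''T'' + arrs s ''pen'' (Bs ! i ! j)))) s"
  unfolding c_swaps_def
proof (rule wpt_For[where N = "length es" and T = 26 and
    I = "\<lambda>n s'. agree {''q'', ''tot''} {} s s' \<and>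
    vars s' ''tot'' = vars s ''tot'' + (\<Sum>q<n. of_bool (arrs s ''mark'' (es ! q) \<noteq> vars s ''st'' \<and>
      vars s ''sum'' + arrs s ''pen'' (es ! q) \<le> vars s ''T'' + arrs s ''pen'' (Bs ! i ! j)))"], goal_cases)
  case (2 q s')
  then have ag: "agree {''q'', ''tot''} {} s s'" by blast
  show ?case using agree_var[OF ag] assms by simp
next
  case (3 q s')
  then have ag: "agree {''q'', ''tot''} {} s s'" by blast
  show ?case using 3(1,3) conjunct2[OF 3(2)] assms(2-)
    by (simp add: wpt_simps agree_simps ag agree_var[OF ag] agree_arr[OF ag] inpD[OF assms(1)] not_less
      del: sum_of_bool_eq)
next
  case (4 t s')
  then show ?case by simp
qed (use assms in \<open>simp add: agree_def\<close>)

text \<open>The summand of \<open>pen_count\<close> in the indexed form that the loops produce, with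
  \<open>D\<close> and \<open>u\<close> for the contents of the arrays \<open>deg\<close> and
  \<open>pen\<close>.\<close>

definition swap_test :: "(nat \<Rightarrow> nat) \<Rightarrow> (nat \<Rightarrow> nat) \<Rightarrow> nat \<Rightarrow> nat list \<Rightarrow> nat \<Rightarrow> nat \<Rightarrow> nat" where
  "swap_test D u T es i j = (if D (Bs ! i ! j) < m then \<Sum>q<length es. of_bool (es ! q \<notin> set (Bs ! i) \<and>
     (\<Sum>j<k. u (Bs ! i ! j)) + u (es ! q) \<le> T + u (Bs ! i ! j)) else 0)"

lemma basis_spec:
  assumes "inp s" "i < m" "vars s ''off'' = i * k"
    and "vars s ''ne'' = length es" "\<And>q. q < length es \<Longrightarrow> arrs s ''elems'' q = es ! q"
    and "\<And>x. arrs s ''mark'' x = vars s ''st'' \<longleftrightarrow> x \<in> set (Bs ! i)"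
    and "vars s ''sum'' = (\<Sum>j<k. arrs s ''pen'' (Bs ! i ! j))"
  shows "wpt c_basis (\<lambda>t s'. t \<le> 100 * (k * (length es + 1)) \<and> agree {''q'', ''tot'', ''j''} {} s s' \<and>
    vars s' ''tot'' = vars s ''tot'' + (\<Sum>j<k. swap_test (arrs s ''deg'') (arrs s ''pen'') (vars s ''T'') es i j)) s"
  unfolding c_basis_def
proof (rule wpt_For[where N = k and T = "40 * (length es + 1) + 10" and
    I = "\<lambda>j s'. agree {''q'', ''tot'', ''j''} {} s s' \<and>
    vars s' ''tot'' = vars s ''tot'' + (\<Sum>j<j. swap_test (arrs s ''deg'') (arrs s ''pen'') (vars s ''T'') es i j)"], goal_cases)
  case (2 j s')
  then have ag: "agree {''q'', ''tot'', ''j''} {} s s'" by blast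
  show ?case using agree_var[OF ag] inpD[OF assms(1)] by simp
next
  case (3 j s')
  then have ag: "agree {''q'', ''tot'', ''j''} {} s s'" by blast
  have inp': "inp s'" using inp_agree[OF ag] assms(1) by simp
  have b: "bval (Less (Read ''deg'' (entry ''off'' ''j'')) (Var ''m'')) s' \<longleftrightarrow> arrs s ''deg'' (Bs ! i ! j) < m"
    using 3(1,3) assms(2,3) by (simp add: agree_var[OF ag] agree_arr[OF ag] inpD[OF assms(1)])
  show ?case
  proof (cases "arrs s ''deg'' (Bs ! i ! j) < m")
    case False
    then show ?thesis unfolding wpt_Cond b using 3(3) conjunct2[OF 3(2)]
      by (simp add: wpt_simps agree_simps ag swap_test_def)
  next
    case True
    then have "wpt c_swaps (\<lambda>t. \<lambda>s''. bcost (Less (Read ''deg'' (entry ''off'' ''j'')) (Var ''m'')) + 1 + t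
          \<le> 40 * (length es + 1) + 10 \<and> vars s'' ''j'' = j \<and>
        agree {''q'', ''tot'', ''j''} {} s (setv ''j'' (Suc j) s'') \<and>
        vars (setv ''j'' (Suc j) s'') ''tot'' = vars s ''tot'' +
          (\<Sum>j<Suc j. swap_test (arrs s ''deg'') (arrs s ''pen'') (vars s ''T'') es i j)) s'"
    proof (intro wpt_mono[OF swaps_spec[OF inp' assms(2) 3(1) _ 3(3), of es]], goal_cases)
      case (4 t1 s1)
      then have ag1: "agree {''q'', ''tot''} {} s' s1" by blast
      have ag2: "agree {''q'', ''tot'', ''j''} {} s s1"
        by (rule agree_trans[OF ag ag1]) auto
      show ?case
        using 4 3(3) conjunct2[OF 3(2)] True
        by (simp add: agree_simps ag2 agree_var[OF ag1] agree_var[OF ag] agree_arr[OF ag] assms(6,7)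
          swap_test_def del: sum_of_bool_eq)
    qed (use assms agree_var[OF ag] agree_arr[OF ag] in auto)
    then show ?thesis unfolding wpt_Cond b using True by (simp only: if_True)
  qed
next
  case (4 t s')
  have "t \<le> k * (40 * (length es + 1) + 10 + 8) + 6" using 4 by simp
  also have "\<dots> = 40 * (k * (length es + 1)) + 18 * k + 6" by (simp add: algebra_simps)
  also have "\<dots> \<le> 100 * (k * (length es + 1))" using sizes by simp
  finally show ?case using 4 by simp
qed (use assms in \<open>simp add: agree_def\<close>)

lemma tot_spec:
  assumes "inp s" "\<And>x. arrs s ''mark'' x \<le> vars s ''st''"
    and "vars s ''ne'' = length es" "\<And>q. q < length es \<Longrightarrow> arrs s ''elems'' q = es ! q"
  shows "wpt c_tot (\<lambda>t s'. t \<le> 300 * (m * (k * (length es + 1))) \<and>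
    agree {''tot'', ''off'', ''i'', ''st'', ''j'', ''sum'', ''q''} {''mark''} s s' \<and>
    (\<forall>x. arrs s' ''mark'' x \<le> vars s' ''st'') \<and> vars s' ''tot'' =
      (\<Sum>i<m. \<Sum>j<k. swap_test (arrs s ''deg'') (arrs s ''pen'') (vars s ''T'') es i j)) s"
  unfolding c_tot_def wpt_Seq wpt_Assign
proof (rule wpt_For[where N = m and T = "24 * k + 40 * k + 100 * (k * (length es + 1)) + 10" and
    I = "\<lambda>i s'. agree {''tot'', ''off'', ''i'', ''st'', ''j'', ''sum'', ''q''} {''mark''} s s' \<and>
    vars s' ''off'' = i * k \<and> (\<forall>x. arrs s' ''mark'' x \<le> vars s' ''st'') \<and> vars s' ''tot'' =
      (\<Sum>i<i. \<Sum>j<k. swap_test (arrs s ''deg'') (arrs s ''pen'') (vars s ''T'') es i j)"], goal_cases)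
  case (2 i s')
  then have ag: "agree {''tot'', ''off'', ''i'', ''st'', ''j'', ''sum'', ''q''} {''mark''} s s'" by blast
  show ?case using agree_var[OF ag] inpD[OF assms(1)] by simp
next
  case (3 i s')
  then have ag: "agree {''tot'', ''off'', ''i'', ''st'', ''j'', ''sum'', ''q''} {''mark''} s s'" by blast
  have inp': "inp s'" using inp_agree[OF ag] assms(1) by simp
  have off: "vars s' ''off'' = i * k" using 3 by blast
  show ?case unfolding wpt_Seq
  proof (rule wpt_mono[OF mark_spec[OF inp' \<open>i < m\<close> off]], goal_cases)
    case (2 t1 s1)
    then have ag1: "agree {''st'', ''j''} {''mark''} s' s1" by blast
    have inp1: "inp s1" using inp_agree[OF ag1] inp' by simp
    have off1: "vars s1 ''off'' = i * k" using off agree_var[OF ag1] by simp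
    show ?case
    proof (rule wpt_mono[OF sum_spec[OF inp1 \<open>i < m\<close> off1]], goal_cases)
      case (1 t2 s2)
      then have ag2: "agree {''sum'', ''j''} {} s1 s2" by blast
      have inp2: "inp s2" using inp_agree[OF ag2] inp1 by simp
      have off2: "vars s2 ''off'' = i * k" using off1 agree_var[OF ag2] by simp
      have ag3: "agree {''tot'', ''off'', ''i'', ''st'', ''j'', ''sum'', ''q''} {''mark''} s' s2"
        by (rule agree_trans[OF ag1 ag2]) auto
      show ?case
      proof (rule wpt_mono[OF basis_spec[OF inp2 \<open>i < m\<close> off2, of es]], goal_cases)
        case (5 t3 s3)
        then have ag4: "agree {''q'', ''tot'', ''j''} {} s2 s3" by blast
        have ag5: "agree {''tot'', ''off'', ''i'', ''st'', ''j'', ''sum'', ''q''} {''mark''} s' s3"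
          by (rule agree_trans[OF ag3 ag4]) auto
        have ag6: "agree {''tot'', ''off'', ''i'', ''st'', ''j'', ''sum'', ''q''} {''mark''} s s3"
          by (rule agree_trans[OF ag ag5]) auto
        show ?case
          using 5 1 2 conjunct2[OF 3(2)] 3(3)
          by (simp add: wpt_simps agree_simps ag6 agree_var[OF ag4] agree_var[OF ag2] agree_var[OF ag1]
            agree_var[OF ag] agree_arr[OF ag4] agree_arr[OF ag2] agree_arr[OF ag1] agree_arr[OF ag] inpD[OF assms(1)])
      qed (use 1 2 assms agree_var[OF ag] agree_arr[OF ag] agree_var[OF ag3] agree_arr[OF ag3]
            agree_var[OF ag2] agree_arr[OF ag2] in auto)
    qed
  qed (use 3 in auto)
next
  case (4 t s')
  have "t \<le> m * (24 * k + 40 * k + 100 * (k * (length es + 1)) + 10 + 8) + 6" using 4 by simp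
  also have "\<dots> = 64 * (m * k) + 100 * (m * (k * (length es + 1))) + 18 * m + 6" by (simp add: algebra_simps)
  finally have "t \<le> 64 * (m * k) + 100 * (m * (k * (length es + 1))) + 18 * m + 6" .
  moreover have "m * k \<le> m * (k * (length es + 1))" by simp
  ultimately have "2 + (2 + t) \<le> 300 * (m * (k * (length es + 1)))"
    using sizes by linarith
  then show ?case using 4 by simp
qed (use assms in \<open>simp add: agree_def\<close>)

end

section \<open>Program counters as degrees and swap counts\<close>

lemma count_list_distinct: "distinct xs \<Longrightarrow> count_list xs x = of_bool (x \<in> set xs)"
  by (induction xs) auto

lemma count_list_concat_distinct:
  "(\<And>b. b \<in> set xs \<Longrightarrow> distinct b) \<Longrightarrow>
   count_list (concat xs) x = (\<Sum>i<length xs. of_bool (x \<in> set (xs ! i)))"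
proof (induction xs)
  case (Cons b xs)
  then show ?case
    by (simp add: count_list_distinct sum.lessThan_Suc_shift del: sum_of_bool_eq sum.lessThan_Suc)
qed simp

context basis_list
begin

abbreviation \<B> where "\<B> \<equiv> set (map set Bs)"

lemma card_bases: "card \<B> = m"
  using distinct_card[OF Bs(2)] by simp

lemma Union_bases: "\<Union>\<B> = set cs"
  by auto

text \<open>Each basis is listed once and without repetitions, so an occurrence in the concatenation
  stands for one basis.\<close>

lemma deg_bases: "deg \<B> x = count_list cs x"
proof -
  have "deg \<B> x = (\<Sum>B\<in>\<B>. of_bool (x \<in> B))"
    unfolding deg_def by (simp add: Int_def)
  also have "\<dots> = (\<Sum>i<m. of_bool (x \<in> set (Bs ! i)))" by (rule sum_bases[symmetric])
  finally show ?thesis using count_list_concat_distinct[of Bs x] Bs by simp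
qed

lemma nth_subset: "i < m \<Longrightarrow> set (Bs ! i) \<subseteq> set cs"
  by (metis UN_upper nth_mem set_concat)

text \<open>Agreement of \<open>u\<close> and \<open>u'\<close> is asked only on elements of bases,
  since \<open>pen\<close> is written nowhere else.\<close>

lemma sum_swap_test:
  assumes "distinct es" "set es = set cs" "\<And>x. x \<in> set cs \<Longrightarrow> u x = u' x"
  shows "(\<Sum>i<m. \<Sum>j<k. swap_test (deg \<B>) u T es i j) = pen_count \<B> u' T"
proof -
  let ?g = "\<lambda>B a. \<Sum>b\<in>\<Union>\<B>. of_bool (deg \<B> a < card \<B> \<and> b \<notin> B \<and> sum u' B + u' b \<le> T + u' a) :: nat"
  have "(\<Sum>j<k. swap_test (deg \<B>) u T es i j) = (\<Sum>a\<in>set (Bs ! i). ?g (set (Bs ! i)) a)" if i: "i < m" for i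
  proof -
    have "swap_test (deg \<B>) u T es i j = ?g (set (Bs ! i)) (Bs ! i ! j)" if j: "j < k" for j
    proof -
      have a: "Bs ! i ! j \<in> set cs" using i j nth_subset[OF i] length_nth[OF i] by (meson nth_mem subsetD)
      have "(\<Sum>j<k. u (Bs ! i ! j)) = sum u' (set (Bs ! i))"
        using i nth_subset[OF i] assms(3) by (subst sum_block) (auto intro: sum.cong)
      moreover have "(\<Sum>q<length es. f (es ! q)) = sum f (set cs)" for f :: "nat \<Rightarrow> nat"
        using sum_nth_distinct[OF assms(1), of f] by (simp only: assms(2))
      note es = this[of "\<lambda>b. of_bool (b \<notin> set (Bs ! i) \<and> sum u' (set (Bs ! i)) + u b \<le> T + u (Bs ! i ! j))"]
      ultimately have "swap_test (deg \<B>) u T es i j = (if deg \<B> (Bs ! i ! j) < m then \<Sum>b\<in>set cs.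
          of_bool (b \<notin> set (Bs ! i) \<and> sum u' (set (Bs ! i)) + u b \<le> T + u (Bs ! i ! j)) else 0)"
        unfolding swap_test_def by (simp only: es)
      then show ?thesis
        unfolding Union_bases card_bases using assms(3) a
        by (auto intro!: sum.cong simp del: sum_of_bool_eq set_concat)
    qed
    then show ?thesis using sum_block[OF i, of "?g (set (Bs ! i))"] by simp
  qed
  then have "(\<Sum>i<m. \<Sum>j<k. swap_test (deg \<B>) u T es i j) = (\<Sum>i<m. \<Sum>a\<in>set (Bs ! i). ?g (set (Bs ! i)) a)"
    by (intro sum.cong[OF refl]) (simp only: lessThan_iff)
  also have "\<dots> = (\<Sum>B\<in>\<B>. \<Sum>a\<in>B. ?g B a)" by (rule sum_bases)
  finally show ?thesis unfolding pen_count_def .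
qed

lemma Max_pen:
  assumes "\<And>x. x \<in> set cs \<Longrightarrow> u x = u' x"
  shows "Max (insert 0 ((\<lambda>i. \<Sum>j<k. u (Bs ! i ! j)) ` {..<m})) = max_pen \<B> u'"
proof -
  have "(\<Sum>j<k. u (Bs ! i ! j)) = sum u' (set (Bs ! i))" if "i < m" for i
    using that nth_subset[OF that] assms by (subst sum_block) (auto intro: sum.cong)
  then have "(\<lambda>i. \<Sum>j<k. u (Bs ! i ! j)) ` {..<m} = (\<lambda>i. sum u' (set (Bs ! i))) ` {..<m}"
    by (intro image_cong) auto
  also have "\<dots> = sum u' ` \<B>"
  proof -
    have "set Bs = (!) Bs ` {..<m}" by (auto simp: set_conv_nth)
    then show ?thesis unfolding set_map image_image by (metis image_image)
  qed
  finally show ?thesis unfolding max_pen_def by simp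
qed

text \<open>Everything that \<open>c_try\<close> reads besides \<open>c\<close> and the cells it
  recomputes. It is preserved, so \<open>c_try\<close> can run again with the second
  candidate.\<close>

definition ready :: "nat list \<Rightarrow> state \<Rightarrow> bool" where
  "ready es s \<longleftrightarrow> inp s \<and> (\<forall>x. arrs s ''mark'' x \<le> vars s ''st'') \<and>
     vars s ''ne'' = length es \<and> (\<forall>q<length es. arrs s ''elems'' q = es ! q) \<and>
     (\<forall>x. arrs s ''deg'' x = deg \<B> x) \<and> vars s ''mn'' = min_deg \<B> \<and> vars s ''mx'' = max_deg \<B> \<and>
     vars s ''adj'' = adj_count \<B> k"

lemma try_spec:
  assumes "ready es s" "distinct es" "set es = set cs" "vars s ''c'' = c"
  shows "wpt c_try (\<lambda>t s'. t \<le> 500 * (m * (k * (length es + 1))) \<and> ready es s' \<and> vars s' ''k'' = k \<and>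
    vars s' ''result'' = (if swap_closed \<B> (penalty \<B> k c) (max_pen \<B> (penalty \<B> k c)) then 1
      else vars s ''result'')) s"
proof -
  let ?u = "penalty \<B> k c"
  have inp: "inp s" using assms unfolding ready_def by blast
  have le: "sum ?u B \<le> max_pen \<B> ?u" if "B \<in> \<B>" for B
    unfolding max_pen_def using that by (intro Max_ge) auto
  have closed: "swap_closed \<B> ?u (max_pen \<B> ?u) \<longleftrightarrow> pen_count \<B> ?u (max_pen \<B> ?u) = adj_count \<B> k"
    using Bs(1) by (intro swap_closed_iff_counts le) (auto simp: distinct_card)
  show ?thesis
    unfolding c_try_def wpt_Seq
  proof (rule wpt_mono[OF pen_spec[OF inp]], goal_cases)
    case (1 t1 s1)
    then have ag1: "agree {''p''} {''pen''} s s1" by blast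
    have inp1: "inp s1" using inp_agree[OF ag1] inp by simp
    have u: "arrs s1 ''pen'' x = ?u x" if "x \<in> set cs" for x
    proof -
      have "arrs s1 ''pen'' x = (if arrs s ''deg'' x = vars s ''mn'' then k + 1
          else if arrs s ''deg'' x = vars s ''mx'' then 0 else vars s ''c'')"
        using 1 that by blast
      then show ?thesis using assms(1,4) unfolding penalty_def ready_def by simp
    qed
    show ?case
    proof (rule wpt_mono[OF max_spec[OF inp1]], goal_cases)
      case (1 t2 s2)
      then have ag2: "agree {''T'', ''off'', ''i'', ''sum'', ''j''} {} s1 s2" by blast
      have inp2: "inp s2" using inp_agree[OF ag2] inp1 by simp
      have u2: "arrs s2 ''pen'' x = ?u x" if "x \<in> set cs" for x
        using u[OF that] agree_arr[OF ag2] by simp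
      have T: "vars s2 ''T'' = max_pen \<B> ?u" using 1 Max_pen[of "arrs s1 ''pen''" ?u] u by simp
      have ag12: "agree {''p'', ''T'', ''off'', ''i'', ''sum'', ''j''} {''pen''} s s2"
        by (rule agree_trans[OF ag1 ag2]) auto
      have pre: "arrs s2 ''mark'' x \<le> vars s2 ''st''" "vars s2 ''ne'' = length es"
        "q < length es \<Longrightarrow> arrs s2 ''elems'' q = es ! q" "arrs s2 ''deg'' = deg \<B>" for x q
        using assms(1) unfolding ready_def
        by (simp_all add: agree_var[OF ag12] agree_arr[OF ag12] fun_eq_iff)
      show ?case
      proof (rule wpt_mono[OF tot_spec[OF inp2 pre(1,2,3)]], goal_cases)
        case (2 t3 s3)
        then have ag3: "agree {''tot'', ''off'', ''i'', ''st'', ''j'', ''sum'', ''q''} {''mark''} s2 s3" by blast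
        have ag13: "agree {''p'', ''T'', ''off'', ''i'', ''sum'', ''j'', ''tot'', ''st'', ''q''} {''pen'', ''mark''} s s3"
          by (rule agree_trans[OF ag12 ag3]) auto
        have inp3: "inp s3" using inp_agree[OF ag3] inp2 by simp
        have "vars s3 ''tot'' = pen_count \<B> ?u (max_pen \<B> ?u)"
          using 2 sum_swap_test[OF assms(2,3), of "arrs s2 ''pen''" ?u] u2 T pre(4) by simp
        moreover have adj: "vars s3 ''adj'' = adj_count \<B> k"
          using assms(1) agree_var[OF ag13] unfolding ready_def by simp
        ultimately have tot: "vars s3 ''tot'' = vars s3 ''adj'' \<longleftrightarrow> swap_closed \<B> ?u (max_pen \<B> ?u)"
          using closed by simp
        have rdy: "ready es s3"
          using assms(1) inp3 2 agree_var[OF ag13] agree_arr[OF ag13] unfolding ready_def by simp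
        then have rdy': "ready es (setv ''result'' 1 s3)" unfolding ready_def inp_def by simp
        have "m * k \<le> m * (k * (length es + 1))" by simp
        moreover have "t1 \<le> 50 * (m * k)" "t2 \<le> 100 * (m * k)" "t3 \<le> 300 * (m * (k * (length es + 1)))"
          using 1 2 \<open>t1 \<le> _ \<and> _\<close> by blast+
        ultimately have "t1 + t2 + t3 + 10 \<le> 500 * (m * (k * (length es + 1)))"
          using sizes by linarith
        then show ?case
          using rdy rdy' tot agree_var[OF ag13] inpD[OF inp3] by (simp add: wpt_simps)
      qed
    qed
  qed
qed

lemma main_spec:
  assumes "matroid_of_rank k E \<B>"
    and "vars s ''k'' = k" "vars s ''m'' = m" "\<And>p. p < m * k \<Longrightarrow> arrs s ''bases'' p = cs ! p"
    and "\<And>x. x \<notin> {''n'', ''k'', ''m''} \<Longrightarrow> vars s x = 0" "\<And>a i. a \<noteq> ''bases'' \<Longrightarrow> arrs s a i = 0"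
  shows "wpt c_main (\<lambda>t s'. t \<le> 3000 * (m * k * (m * k)) \<and>
    vars s' ''result'' = (if threshold_matroid k E \<B> then 1 else 0)) s"
proof -
  \<comment> \<open>The 4 units are reserved for the initial test of \<open>k\<close>.\<close>
  have "wpt (Seq c_len (Seq c_deg (Seq c_ext (Seq c_adj
      (Seq (Assign ''c'' (Const 1)) (Seq c_try (Seq (Assign ''c'' (Var ''k'')) c_try)))))))
    (\<lambda>t s'. 4 + t \<le> 3000 * (m * k * (m * k)) \<and>
      vars s' ''result'' = (if threshold_matroid k E \<B> then 1 else 0)) s"
    unfolding wpt_Seq
  proof (rule wpt_mono[OF len_spec[OF assms(2,3) _ assms(4)]], goal_cases)
    case (3 t1 s1)
    then have ag1: "agree {''len'', ''i''} {} s s1" and inp1: "inp s1" by auto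
    show ?case
    proof (rule wpt_mono[OF deg_spec[OF inp1]], goal_cases)
      case (3 t2 s2)
      then have ag2: "agree {''p'', ''ne''} {''deg'', ''elems''} s1 s2" by blast
      have ag12: "agree {''len'', ''i'', ''p'', ''ne''} {''deg'', ''elems''} s s2"
        by (rule agree_trans[OF ag1 ag2]) auto
      have inp2: "inp s2" using inp_agree[OF ag2] inp1 by simp
      obtain es where es: "distinct es" "set es = set cs" "vars s2 ''ne'' = length es"
        "\<And>q. q < length es \<Longrightarrow> arrs s2 ''elems'' q = es ! q" using 3 by blast
      have D: "arrs s2 ''deg'' = deg \<B>" using 3 deg_bases by auto
      \<comment> \<open>The elements of bases occupy at most \<open>m * k\<close> cells, which
        bounds the swap loops by the square of \<open>m * k\<close> plus a lower-order term.\<close>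
      have "length es \<le> m * k"
        using distinct_card[OF es(1)] card_length[of cs] es(2) length_cs by simp
      then have "m * (k * (length es + 1)) \<le> m * (k * (m * k + 1))" by (intro mult_le_mono2) simp
      also have "\<dots> = m * k * (m * k) + m * k" by (simp add: algebra_simps)
      finally have bound: "m * (k * (length es + 1)) \<le> m * k * (m * k) + m * k" .
      show ?case
      proof (rule wpt_mono[OF ext_spec[OF inp2]], goal_cases)
        case (1 t3 s3)
        then have ag3: "agree {''p'', ''mn'', ''mx'', ''x''} {} s2 s3" by blast
        have ag13: "agree {''len'', ''i'', ''p'', ''ne'', ''mn'', ''mx'', ''x''} {''deg'', ''elems''} s s3"
          by (rule agree_trans[OF ag12 ag3]) auto
        have inp3: "inp s3" using inp_agree[OF ag3] inp2 by simp
        have mnx: "vars s3 ''mn'' = min_deg \<B>" "vars s3 ''mx'' = max_deg \<B>"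
          using 1 unfolding min_deg_def max_deg_def Union_bases card_bases D by auto
        show ?case
        proof (rule wpt_mono[OF adj_spec[OF inp3]], goal_cases)
          case (3 t4 s4)
          then have ag4: "agree {''st'', ''cnt'', ''j'', ''adj'', ''off2'', ''h'', ''off'', ''i''} {''mark''} s3 s4" by blast
          have ag14: "agree {''len'', ''i'', ''p'', ''ne'', ''mn'', ''mx'', ''x'', ''st'', ''cnt'', ''j'', ''adj'', ''off2'', ''h'', ''off''}
            {''deg'', ''elems'', ''mark''} s s4"
            by (rule agree_trans[OF ag13 ag4]) auto
          have inp4: "inp s4" using inp_agree[OF ag4] inp3 by simp
          have "ready es s4"
            using inp4 3 es(3,4) D mnx agree_var[OF ag4] agree_arr[OF ag4] agree_var[OF ag3] agree_arr[OF ag3]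
            unfolding ready_def by simp
          then have rdy: "ready es (setv ''c'' 1 s4)" unfolding ready_def inp_def by simp
          have res: "vars s4 ''result'' = 0" using agree_var[OF ag14] assms(5) by simp
          show ?case unfolding wpt_Assign aval.simps
          proof (rule wpt_mono[OF try_spec[OF rdy es(1,2), of 1]], goal_cases)
            case (2 t5 s5)
            then have rdy5: "ready es (setv ''c'' k s5)" unfolding ready_def inp_def by simp
            have k5: "vars s5 ''k'' = k" using 2 by simp
            show ?case unfolding k5
            proof (rule wpt_mono[OF try_spec[OF rdy5 es(1,2), of k]], goal_cases)
              case (2 t6 s6)
              have res6: "vars s6 ''result'' = (if threshold_matroid k E \<B> then 1 else 0)"
                using 2 \<open>t5 \<le> _ \<and> _\<close> res threshold_iff_swap_closed[OF assms(1)] k by auto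
              have "t1 \<le> 20 * (m * k)" "t2 \<le> 50 * (m * k)" "t3 \<le> 50 * (m * k)"
                "t4 \<le> 200 * (m * (m * k))" "t5 \<le> 500 * (m * (k * (length es + 1)))"
                "t6 \<le> 500 * (m * (k * (length es + 1)))"
                using 1 2 3 \<open>t1 \<le> _ \<and> _\<close> \<open>t2 \<le> _ \<and> _\<close> \<open>t5 \<le> _ \<and> _\<close> by blast+
              moreover have "m * (m * k) \<le> m * k * (m * k)" using sizes by simp
              moreover have "m * k \<le> m * k * (m * k)" using sizes by simp
              \<comment> \<open>Each of \<open>t5\<close> and \<open>t6\<close> is at most 1000
                times the square of \<open>m * k\<close>, as \<open>bound\<close> at most doubles
                it; the other parts contribute at most 320 times the square, plus the
                constant.\<close>
              ultimately have "t1 + t2 + t3 + t4 + t5 + t6 + 20 \<le> 3000 * (m * k * (m * k))"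
                using bound sizes by linarith
              then show ?case using res6 by simp
            qed simp
          qed simp
        qed (use assms(5,6) agree_var[OF ag13] agree_arr[OF ag13] in auto)
      qed
    qed (use assms(5,6) agree_var[OF ag1] agree_arr[OF ag1] in auto)
  qed (use assms in auto)
  moreover have "\<not> bval (Equal (Var ''k'') (Const 0)) s" "bcost (Equal (Var ''k'') (Const 0)) + 1 = 4"
    using k assms(2) by simp_all
  ultimately show ?thesis
    unfolding c_main_def wpt_Cond by (simp only: if_False)
qed

end

theorem theorem41:
  "\<exists>(c :: com) (C :: real). \<forall>(n :: nat) (k :: nat) (m :: nat) (\<B> :: nat set set) (Bs :: nat list list).
     matroid_of_rank k {..<n} \<B> \<and> card \<B> = m \<and> listing \<B> Bs \<longrightarrow>
     runs_within c (input_state n k Bs)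
       (C * (real m ^ 2 * real k ^ 2 + real n * log 2 (real n) + 1))
       (if threshold_matroid k {..<n} \<B> then 1 else 0)"
proof (intro exI allI impI)
  fix n k m :: nat and \<B> :: "nat set set" and Bs :: "nat list list"
  assume "matroid_of_rank k {..<n} \<B> \<and> card \<B> = m \<and> listing \<B> Bs"
  then have M: "matroid_of_rank k {..<n} \<B>" and m: "card \<B> = m"
    and L: "distinct (map set Bs)" "set (map set Bs) = \<B>" "\<And>b. b \<in> set Bs \<Longrightarrow> distinct b"
    unfolding listing_def by auto
  have lenm: "length Bs = m" using distinct_card[OF L(1)] L(2) m by simp
  have nlogn: "0 \<le> real n * log 2 (real n)"
    by (cases n) auto
  show "runs_within c_main (input_state n k Bs)
       (3000 * (real m ^ 2 * real k ^ 2 + real n * log 2 (real n) + 1))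
       (if threshold_matroid k {..<n} \<B> then 1 else 0)"
  proof (cases "k = 0")
    case True
    then have "\<not> threshold_matroid k {..<n} \<B>" using threshold_iff_swap_closed[OF M] by simp
    \<comment> \<open>The product vanishes for \<open>k = 0\<close>; the 5 units are covered by the
      additive 1 in the bound.\<close>
    moreover have "wpt c_main (\<lambda>t s'. t \<le> 5 \<and> vars s' ''result'' = 0) (input_state n k Bs)"
      unfolding c_main_def wpt_Cond using True by (simp add: input_state_def wpt_Skip)
    ultimately show ?thesis
      using nlogn True unfolding runs_within_def wpt_def by fastforce
  next
    case False
    have lb: "length b = k" if "b \<in> set Bs" for b
      using M that L distinct_card[of b] unfolding matroid_of_rank_def by force
    interpret basis_list k Bs
      using False lb L M unfolding matroid_of_rank_def matroid_def by unfold_locales auto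
    have "matroid_of_rank k {..<n} (set (map set Bs))" unfolding L(2) by (rule M)
    then have "wpt c_main (\<lambda>t s'. t \<le> 3000 * (length Bs * k * (length Bs * k)) \<and>
        vars s' ''result'' = (if threshold_matroid k {..<n} (set (map set Bs)) then 1 else 0)) (input_state n k Bs)"
      by (rule main_spec) (auto simp: input_state_def length_cs)
    then obtain t s' where "runs c_main (input_state n k Bs) t s'" "t \<le> 3000 * (m * k * (m * k))"
        "vars s' ''result'' = (if threshold_matroid k {..<n} \<B> then 1 else 0)"
      unfolding wpt_def lenm L(2) by blast
    moreover from this(2) have "real t \<le> 3000 * (real m * real k * (real m * real k))"
      by (metis of_nat_le_iff of_nat_mult of_nat_numeral)
    then have "real t \<le> 3000 * (real m ^ 2 * real k ^ 2 + real n * log 2 (real n) + 1)"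
      using nlogn by (simp add: power2_eq_square algebra_simps)
    ultimately show ?thesis unfolding runs_within_def by blast
  qed
qed

end
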